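(* Let $k>1$ be an integer, $D>0$ a non-square discriminant, and let $\mathcal{C}$ be a connected component of $\mathbb{H}\setminus E_D$. Then there exists a polynomial $P_{\mathcal{C}}$ of degree at most $2k-2$ such that for all $\tau\in\mathcal{C}$, $$\mathcal{F}_{1-k,D}(\tau)=P_{\mathcal{C}}(\tau)+D^{\frac12-k}f_{k,D}^*(\tau)-D^{\frac12-k}\frac{(2k-2)!}{(4\pi)^{2k-1}}\mathcal{E}_{f_{k,D}}(\tau).$$
   Context: Write $\tau=x+iy\in\mathbb{H}$, $q=e^{2\pi i\tau}$. A discriminant is an integer $\equiv0,1\pmod4$. $\mathcal{Q}_D$ is the set of $Q=[a,b,c]$, $Q(X,Y)=aX^2+bXY+cY^2$, $a,b,c\in\mathbb{Z}$, $b^2-4ac=D$. Let $\psi(v):=\frac12\int_0^v u^{k-\frac32}(1-u)^{-\frac12}du$. Define $$\mathcal{F}_{1-k,D}(\tau):=\frac{D^{\frac12-k}}{\binom{2k-2}{k-1}\pi}\sum_{Q=[a,b,c]\in\mathcal{Q}_D}\operatorname{sgn}\left(a|\tau|^2+bx+c\right)Q(\tau,1)^{k-1}\psi\left(\frac{Dy^2}{|Q(\tau,1)|^2}\right)$$ ($\operatorname{sgn}(0)=0$) and $f_{k,D}(\tau):=\frac{D^{k-\frac12}}{\binom{2k-2}{k-1}\pi}\sum_{[a,b,c]\in\mathcal{Q}_D}(a\tau^2+b\tau+c)^{-k}$, a cusp form of weight $2k$ on $\mathrm{SL}_2(\mathbb{Z})$. $E_D:=\{\tau\in\mathbb{H}:\exists[a,b,c]\in\mathcal{Q}_D,\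 a|\tau|^2+bx+c=0\}$. For a cusp form $f(\tau)=\sum_{n\ge1}a_nq^n$ of weight $2k$, the non-holomorphic Eichler integral is $f^*(\tau):=(2i)^{1-2k}\int_{-\overline{\tau}}^{i\infty}\overline{f(-\overline{z})}\,(z+\tau)^{2k-2}dz$ and the holomorphic Eichler integral is $\mathcal{E}_f(\tau):=\sum_{n\ge1}\frac{a_n}{n^{2k-1}}q^n$.
   Formalization: The non-holomorphic Eichler integral f* is taken with constant (-2i)^{1-2k} instead of (2i)^{1-2k}; with the printed constant the identity has the wrong sign and fails whenever f_{k,D} is nonzero, e.g. k=6, D=5. *)

theory Defs
  imports "HOL-Complex_Analysis.Complex_Analysis" "HOL-Computational_Algebra.Polynomial"
begin

definition upper_half_plane :: "complex set" where
  "upper_half_plane = {\<tau>. Im \<tau> > 0}"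

definition discriminant :: "int \<Rightarrow> bool" where
  "discriminant D \<longleftrightarrow> D mod 4 = 0 \<or> D mod 4 = 1"

definition forms :: "int \<Rightarrow> (int \<times> int \<times> int) set" where
  "forms D = {(a, b, c). b\<^sup>2 - 4 * a * c = D}"

definition form_at :: "int \<times> int \<times> int \<Rightarrow> complex \<Rightarrow> complex" where
  "form_at = (\<lambda>(a, b, c) \<tau>. of_int a * \<tau>\<^sup>2 + of_int b * \<tau> + of_int c)"

definition geodesic_fun :: "int \<times> int \<times> int \<Rightarrow> complex \<Rightarrow> real" where
  "geodesic_fun = (\<lambda>(a, b, c) \<tau>. of_int a * (cmod \<tau>)\<^sup>2 + of_int b * Re \<tau> + of_int c)"

definition exceptional_set :: "int \<Rightarrow> complex set" where
  "exceptional_set D =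
     {\<tau> \<in> upper_half_plane. \<exists>Q \<in> forms D. geodesic_fun Q \<tau> = 0}"

(* At v = 1 the integrand is unbounded near u = 1 but integrable; "powr" assigns it the
   value 0 at the endpoint, which does not affect the integral. *)
definition psi :: "nat \<Rightarrow> real \<Rightarrow> real" where
  "psi k v = 1 / 2 * integral {0..v}
     (\<lambda>u. u powr (real k - 3 / 2) * (1 - u) powr (- 1 / 2))"

definition F_fun :: "nat \<Rightarrow> int \<Rightarrow> complex \<Rightarrow> complex" where
  "F_fun k D \<tau> =
     of_real (real_of_int D powr (1 / 2 - real k) / (real ((2 * k - 2) choose (k - 1)) * pi)) *
     (\<Sum>\<^sub>\<infinity>Q \<in> forms D.
        of_real (sgn (geodesic_fun Q \<tau>)) * form_at Q \<tau> ^ (k - 1) *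
        of_real (psi k (real_of_int D * (Im \<tau>)\<^sup>2 / (cmod (form_at Q \<tau>))\<^sup>2)))"

definition f_form :: "nat \<Rightarrow> int \<Rightarrow> complex \<Rightarrow> complex" where
  "f_form k D \<tau> =
     of_real (real_of_int D powr (real k - 1 / 2) / (real ((2 * k - 2) choose (k - 1)) * pi)) *
     (\<Sum>\<^sub>\<infinity>Q \<in> forms D. 1 / form_at Q \<tau> ^ k)"

definition nome :: "complex \<Rightarrow> complex" where
  "nome \<tau> = exp (2 * of_real pi * \<i> * \<tau>)"

(* The coefficients a_n in f = sum_{n >= 1} a_n q^n; the index 0, which does not occur, is
   pinned to 0 so that the coefficient sequence is unique. *)
definition cusp_coeff :: "(complex \<Rightarrow> complex) \<Rightarrow> nat \<Rightarrow> complex" where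
  "cusp_coeff f = (THE a. a 0 = 0 \<and>
     (\<forall>\<tau> \<in> upper_half_plane. (\<lambda>n. a n * nome \<tau> ^ n) sums f \<tau>))"

(* The path from -conj(tau) to i*infinity is the vertical ray.
   The constant is (-2i)^(1-2k), not the (2i)^(1-2k) that appears in print. With
   xi_{2-2k}(g) = 2i y^(2-2k) conj(dg/d conj(tau)), it gives xi_{2-2k}(f* ) = f, whereas
   (2i)^(1-2k) gives xi_{2-2k}(f* ) = -f. Differentiating the series termwise off the
   exceptional set yields xi_{2-2k}(F_fun k D) = D^(1/2-k) f_form k D, so
   F_fun k D - D^(1/2-k) f* is holomorphic there only with the sign chosen here. *)
definition nonhol_eichler :: "nat \<Rightarrow> (complex \<Rightarrow> complex) \<Rightarrow> complex \<Rightarrow> complex" where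
  "nonhol_eichler k f \<tau> =
     (- 2 * \<i>) powi (1 - 2 * int k) *
     Lim at_top (\<lambda>T::real.
       contour_integral (linepath (- cnj \<tau>) (- cnj \<tau> + \<i> * of_real T))
         (\<lambda>z. cnj (f (- cnj z)) * (z + \<tau>) ^ (2 * k - 2)))"

definition hol_eichler :: "nat \<Rightarrow> (complex \<Rightarrow> complex) \<Rightarrow> complex \<Rightarrow> complex" where
  "hol_eichler k f \<tau> =
     (\<Sum>n. cusp_coeff f (Suc n) / of_nat (Suc n) ^ (2 * k - 1) * nome \<tau> ^ Suc n)"

end

theory Submission
  imports Defs
begin

text \<open>
  Off the exceptional set, every term of the series for \<open>F\<close> is an integral of
  \<open>(z - \<tau>)^(2k-2) Q(z)^(-k)\<close> up to a polynomial. Put \<open>w = arctan (\<surd>D y / g)\<close>,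
  \<open>g = a|\<tau>|\<^sup>2 + bx + c\<close>. Then \<open>sin\<^sup>2 w = D y\<^sup>2 / |Q(\<tau>)|\<^sup>2\<close>, so that
  \<open>sgn g \<psi>(D y\<^sup>2 / |Q(\<tau>)|\<^sup>2)\<close> is the integral of \<open>sin^(2k-2)\<close> from \<open>0\<close> to \<open>w\<close>, and
  \<open>exp (2iw) = \<mu>(\<tau>) / \<mu>(cnj \<tau>)\<close>, where \<open>\<mu>(z) = (z - \<alpha>) / (z - \<beta>)\<close> and \<open>\<alpha>\<close>, \<open>\<beta>\<close> are the roots
  of \<open>Q(z, 1)\<close>. Replacing \<open>\<mu>(cnj \<tau>)\<close> by \<open>\<mu>(z)\<close> gives a function of two complex variables
  whose \<open>z\<close>-derivative is a constant times \<open>(z - \<tau>)^(2k-2) Q(z)^(-k)\<close>, and whose difference at two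
  base points \<open>z\<close> is a polynomial in \<open>\<tau>\<close> of degree at most \<open>2k - 2\<close>. The branch of the logarithm of
  \<open>\<mu>(\<tau>) / \<mu>(cnj \<tau>)\<close> is off by a multiple of \<open>2\<pi>i\<close> that is constant on a component and
  contributes a multiple of \<open>Q(\<tau>)^(k-1)\<close>.

  Hence, with base point \<open>\<tau>\<^sub>0\<close> in the component, each term is a polynomial plus one integral from
  \<open>\<tau>\<^sub>0\<close> to \<open>\<tau>\<close> and one from \<open>-cnj \<tau>\<^sub>0\<close> to \<open>-cnj \<tau>\<close>. The terms and the integrals are summable
  over \<open>Q\<close>, so the polynomials are pointwise summable, and their sum is a polynomial by Lagrange
  interpolation. The summed integrals agree with the two Eichler integrals of \<open>f\<close> up to polynomials, by
  repeated integration by parts with the antiderivatives read off from the Fourier expansion.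
\<close>

subsection \<open>Forms with a given middle coefficient\<close>

lemma card_divisors_mult_le:
  fixes m n :: nat
  assumes "m > 0" "n > 0"
  shows "card {d. d dvd m * n} \<le> card {d. d dvd m} * card {d. d dvd n}"
proof -
  have fin: "finite {d. d dvd m}" "finite {d. d dvd n}"
    using assms by (auto intro: finite_divisors_nat)
  have "{d. d dvd m * n} \<subseteq> (\<lambda>(x, y). x * y) ` ({d. d dvd m} \<times> {d. d dvd n})"
    by (force elim!: dvd_productE)
  then have "card {d. d dvd m * n} \<le> card ({d. d dvd m} \<times> {d. d dvd n})"
    using fin by (meson card_image_le card_mono finite_SigmaI finite_imageI le_trans)
  then show ?thesis by (simp add: card_cartesian_product)
qed

lemma card_divisors_prime_power:
  fixes p :: nat
  assumes "prime p"
  shows "card {d. d dvd p ^ e} \<le> e + 1"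
proof -
  have "{d. d dvd p ^ e} \<subseteq> (\<lambda>i. p ^ i) ` {..e}"
    using assms by (auto simp: divides_primepow_nat)
  then have "card {d. d dvd p ^ e} \<le> card {..e}"
    by (meson card_image_le card_mono finite_atMost finite_imageI le_trans)
  then show ?thesis by simp
qed

text \<open>The ratio \<open>(e + 1) ^ 3 / 2 ^ e\<close> is largest at \<open>e = 3\<close>, where
  it equals 8. From there on the power of two outgrows the cube: for \<open>e \<ge> 5\<close> the
  step from \<open>e ^ 3\<close> to \<open>(e + 1) ^ 3\<close> less than doubles the value.\<close>

lemma cube_Suc_le: "(e + 1) ^ 3 \<le> 8 * 2 ^ (e::nat)"
proof (induction e rule: less_induct)
  case (less e)
  show ?case
  proof (cases "e \<le> 4")
    case True
    then have "e = 0 \<or> e = 1 \<or> e = 2 \<or> e = 3 \<or> e = 4" by auto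
    then show ?thesis by (auto simp: power3_eq_cube)
  next
    case False
    \<comment> \<open>With \<open>e = d + 5\<close> the comparison of the two cubes holds
      coefficient by coefficient in \<open>d\<close>.\<close>
    define d where "d = e - 5"
    have e: "e = Suc (d + 4)" using False by (simp add: d_def)
    have "(d + 4 + 1) ^ 3 \<le> 8 * 2 ^ (d + 4)" using less[of "d + 4"] e by simp
    moreover have "(e + 1) ^ 3 \<le> 2 * (d + 4 + 1) ^ 3"
      unfolding e by (simp add: power3_eq_cube algebra_simps)
    moreover have "8 * 2 ^ e = 2 * (8 * 2 ^ (d + 4) :: nat)" by (simp add: e eval_nat_numeral)
    ultimately show ?thesis by linarith
  qed
qed

text \<open>Primes \<open>p \<ge> 8\<close> cost nothing, as
  \<open>(e + 1) ^ 3 \<le> 8 ^ e \<le> p ^ e\<close>. Only the finitely many smaller primes cost a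
  factor, which keeps the constant for general \<open>n\<close> bounded.\<close>

lemma card_divisors_prime_power_cube:
  fixes p :: nat
  assumes "prime p"
  shows "card {d. d dvd p ^ e} ^ 3 \<le> (if p < 8 then 8 else 1) * p ^ e"
proof -
  have "card {d. d dvd p ^ e} ^ 3 \<le> (e + 1) ^ 3"
    using card_divisors_prime_power[OF assms] by (rule power_mono) simp
  also have "\<dots> \<le> (if p < 8 then 8 else 1) * p ^ e"
  proof (cases "p < 8")
    case True
    have "(2::nat) ^ e \<le> p ^ e" using prime_ge_2_nat[OF assms] by (rule power_mono) simp
    then show ?thesis using True cube_Suc_le[of e] by simp
  next
    case False
    have "e + 1 \<le> 2 ^ e" by (induction e) auto
    then have "(e + 1) ^ 3 \<le> (2 ^ e) ^ 3" by (rule power_mono) simp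
    also have "\<dots> = 8 ^ e" using power_mult[of "2::nat" e 3] power_mult[of "2::nat" 3 e] by (simp add: mult.commute)
    also have "\<dots> \<le> p ^ e" using False by (intro power_mono) auto
    finally show ?thesis using False by simp
  qed
  finally show ?thesis .
qed

lemma card_divisors_prod_prime_powers:
  fixes A :: "nat set"
  assumes "finite A" "\<And>p. p \<in> A \<Longrightarrow> prime p"
  shows "card {d. d dvd (\<Prod>p\<in>A. p ^ e p)} ^ 3
    \<le> (\<Prod>p\<in>A. if p < 8 then 8 else 1) * (\<Prod>p\<in>A. p ^ e p)"
  using assms
proof (induction A rule: finite_induct)
  case empty
  then show ?case by simp
next
  case (insert p A)
  have pos: "p ^ e p > 0" "(\<Prod>p\<in>A. p ^ e p) > 0"
    using insert.prems by (auto intro!: prod_pos simp: prime_gt_0_nat)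
  have "card {d. d dvd (\<Prod>p\<in>insert p A. p ^ e p)} ^ 3
      \<le> (card {d. d dvd p ^ e p} * card {d. d dvd (\<Prod>p\<in>A. p ^ e p)}) ^ 3"
    using insert card_divisors_mult_le[OF pos] by (intro power_mono) auto
  also have "\<dots> \<le> ((if p < 8 then 8 else 1) * p ^ e p)
      * ((\<Prod>p\<in>A. if p < 8 then 8 else 1) * (\<Prod>p\<in>A. p ^ e p))"
    unfolding power_mult_distrib
    using insert by (intro mult_mono card_divisors_prime_power_cube) auto
  finally show ?case using insert by (simp add: algebra_simps)
qed

lemma card_divisors_cube_le:
  fixes n :: nat
  assumes "n > 0"
  shows "card {d. d dvd n} ^ 3 \<le> 8 ^ 8 * n"
proof -
  let ?A = "prime_factors n"
  have n: "(\<Prod>p\<in>?A. p ^ multiplicity p n) = n"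
    using assms by (simp add: prod_prime_factors)
  have "(\<Prod>p\<in>?A. if p < 8 then 8 else 1) = (\<Prod>p\<in>?A \<inter> {..<8}. 8::nat)"
    by (subst prod.inter_restrict) (auto intro!: prod.cong)
  also have "\<dots> = 8 ^ card (?A \<inter> {..<8})" by simp
  \<comment> \<open>A crude count: there are 8 natural numbers below 8, prime or not.\<close>
  also have "\<dots> \<le> 8 ^ 8"
    using card_mono[of "{..<8}" "?A \<inter> {..<8}"] by (intro power_increasing) auto
  finally have *: "(\<Prod>p\<in>?A. if p < 8 then 8 else 1) \<le> (8 ^ 8 :: nat)" .
  have "card {d. d dvd n} ^ 3 \<le> (\<Prod>p\<in>?A. if p < 8 then 8 else 1) * n"
    using card_divisors_prod_prime_powers[of ?A "\<lambda>p. multiplicity p n"] n by auto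
  also have "\<dots> \<le> 8 ^ 8 * n" using * by simp
  finally show ?thesis .
qed

text \<open>For \<open>k = 2\<close> the trivial divisor bound \<open>O(\<surd>n)\<close> would leave a logarithmically divergent sum over
  the middle coefficient; any exponent below \<open>1/2\<close> suffices.\<close>

lemma card_divisors_le_powr:
  fixes n :: nat
  assumes "n > 0"
  shows "real (card {d. d dvd n}) \<le> 256 * real n powr (1/3)"
proof -
  have cube: "(x ^ 3) powr (1/3) = x" if "x > 0" for x :: real
  proof -
    have "x ^ 3 = x powr 3" using that by simp
    then show ?thesis using that by (simp only: powr_powr) simp
  qed
  have "finite {d. d dvd n}" "1 \<in> {d. d dvd n}" using assms by (auto intro: finite_divisors_nat)
  then have "card {d. d dvd n} > 0" using card_gt_0_iff by blast
  then have "real (card {d. d dvd n}) = (real (card {d. d dvd n}) ^ 3) powr (1/3)"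
    by (subst cube) auto
  \<comment> \<open>Since \<open>8 ^ 8 = 256 ^ 3\<close>, the cube root of the constant is
    256.\<close>
  also have "\<dots> \<le> (256 ^ 3 * real n) powr (1/3)"
  proof (rule powr_mono2)
    have "real (card {d. d dvd n} ^ 3) \<le> real (8 ^ 8 * n)"
      using card_divisors_cube_le[OF assms] of_nat_le_iff by blast
    then show "real (card {d. d dvd n}) ^ 3 \<le> 256 ^ 3 * real n" by simp
  qed auto
  also have "\<dots> = (256 ^ 3) powr (1/3) * real n powr (1/3)"
    by (rule powr_mult)
  also have "\<dots> = 256 * real n powr (1/3)"
    by (subst cube) auto
  finally show ?thesis .
qed

section \<open>Counting forms and the basic majorant\<close>

lemma form_coeff_nonzero:
  assumes "\<nexists>m::int. D = m\<^sup>2" "(a, b, c) \<in> forms D"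
  shows "a \<noteq> 0"
  using assms by (auto simp: forms_def)

text \<open>For fixed \<open>b\<close>, the coefficient \<open>a\<close> is nonzero, divides
  \<open>b\<^sup>2 - D\<close> and determines \<open>c\<close>. As \<open>D\<close> is not a square,
  \<open>b\<^sup>2 - D\<close> is nonzero and has finitely many divisors. The two signs of
  \<open>a\<close> give \<open>512 = 2 * 256\<close>, and \<open>\<bar>b\<^sup>2 - D\<bar> \<le> D *
  (1 + \<bar>b\<bar>)\<^sup>2\<close> turns the exponent 1/3 into 2/3.\<close>

lemma card_forms_middle:
  assumes sq: "\<nexists>m::int. D = m\<^sup>2" and D: "D > 0"
  shows "finite {Q \<in> forms D. fst (snd Q) = b}"
    and "real (card {Q \<in> forms D. fst (snd Q) = b}) \<le> 512 * real_of_int D * (1 + \<bar>real_of_int b\<bar>) powr (2/3)"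
proof -
  let ?S = "{Q \<in> forms D. fst (snd Q) = b}"
  define n where "n = nat \<bar>b\<^sup>2 - D\<bar>"
  have n0: "n > 0" using sq by (auto simp: n_def)
  let ?d = "{d. d dvd n}"
  have fin: "finite ?d" using n0 by (simp add: finite_divisors_nat)
  have inj: "inj_on fst ?S"
  proof (rule inj_onI)
    fix P Q assume "P \<in> ?S" "Q \<in> ?S" "fst P = fst Q"
    then show "P = Q" using form_coeff_nonzero[OF sq]
      by (cases P; cases Q) (auto simp: forms_def)
  qed
  have sub: "fst ` ?S \<subseteq> int ` ?d \<union> (\<lambda>x. - int x) ` ?d"
  proof
    fix a assume "a \<in> fst ` ?S"
    then obtain c where "(a, b, c) \<in> forms D" by auto
    then have "4 * a * c = b\<^sup>2 - D" by (simp add: forms_def)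
    then have "a dvd \<bar>b\<^sup>2 - D\<bar>" by (metis dvd_abs_iff dvd_triv_left mult.assoc mult.left_commute)
    then have "nat \<bar>a\<bar> dvd n" by (simp add: n_def nat_abs_dvd_iff)
    moreover have "a = int (nat \<bar>a\<bar>) \<or> a = - int (nat \<bar>a\<bar>)" by auto
    ultimately show "a \<in> int ` ?d \<union> (\<lambda>x. - int x) ` ?d" by blast
  qed
  have fin2: "finite (int ` ?d \<union> (\<lambda>x. - int x) ` ?d)" using fin by auto
  show "finite ?S" using finite_imageD[OF finite_subset[OF sub fin2] inj] .
  have "card ?S = card (fst ` ?S)" using card_image[OF inj] by simp
  also have "\<dots> \<le> card (int ` ?d \<union> (\<lambda>x. - int x) ` ?d)" by (rule card_mono[OF fin2 sub])
  also have "\<dots> \<le> card ?d + card ?d"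
    by (rule le_trans[OF card_Un_le add_mono]) (auto intro: card_image_le fin)
  finally have 1: "real (card ?S) \<le> 2 * real (card ?d)" by simp
  have "real n = \<bar>(real_of_int b)\<^sup>2 - real_of_int D\<bar>" by (simp add: n_def)
  also have "\<dots> \<le> real_of_int D * (1 + \<bar>real_of_int b\<bar>)\<^sup>2"
  proof -
    have "1 * (real_of_int b)\<^sup>2 \<le> D * (real_of_int b)\<^sup>2" using D by (intro mult_right_mono) auto
    moreover have "0 \<le> D * \<bar>real_of_int b\<bar>" using D by simp
    moreover have "real_of_int D > 0" using D by simp
    moreover have "D * (1 + \<bar>real_of_int b\<bar>)\<^sup>2 = D + 2 * (D * \<bar>real_of_int b\<bar>) + D * (real_of_int b)\<^sup>2"
      by (simp add: power2_eq_square algebra_simps)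
    moreover have "(real_of_int b)\<^sup>2 \<ge> 0" by simp
    ultimately show ?thesis unfolding abs_le_iff by linarith
  qed
  finally have "real n powr (1/3) \<le> (real_of_int D * (1 + \<bar>real_of_int b\<bar>)\<^sup>2) powr (1/3)"
    by (intro powr_mono2) auto
  also have "\<dots> = D powr (1/3) * (1 + \<bar>real_of_int b\<bar>) powr (2/3)"
  proof -
    have "(1 + \<bar>real_of_int b\<bar>)\<^sup>2 = (1 + \<bar>real_of_int b\<bar>) powr 2" by simp
    then show ?thesis using D by (simp only: powr_mult powr_powr) simp
  qed
  also have "\<dots> \<le> D * (1 + \<bar>real_of_int b\<bar>) powr (2/3)"
    using D powr_mono[of "1/3" 1 "real_of_int D"] by (intro mult_right_mono) auto
  finally have 2: "real n powr (1/3) \<le> \<dots>" .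
  show "real (card ?S) \<le> 512 * real_of_int D * (1 + \<bar>real_of_int b\<bar>) powr (2/3)"
    using 1 2 card_divisors_le_powr[OF n0] by linarith
qed

lemma summable_on_int_powr:
  assumes "s > 1"
  shows "(\<lambda>b::int. (1 + \<bar>real_of_int b\<bar>) powr (- s)) summable_on UNIV"
proof -
  have "summable (\<lambda>n::nat. (1 + real n) powr (-s))"
  proof -
    have "summable (\<lambda>n. real n powr (-s))" using assms by (simp add: summable_real_powr_iff)
    then have "summable (\<lambda>n. real (Suc n) powr (-s))" by (subst summable_Suc_iff)
    then show ?thesis by (simp add: add.commute)
  qed
  then have s: "(\<lambda>n::nat. (1 + real n) powr (-s)) summable_on UNIV"
    by (subst summable_on_UNIV_nonneg_real_iff) auto
  have "(\<lambda>b::int. (1 + \<bar>real_of_int b\<bar>) powr (- s)) summable_on range int"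
    by (subst summable_on_reindex) (use s in \<open>auto simp: o_def\<close>)
  moreover have "(\<lambda>b::int. (1 + \<bar>real_of_int b\<bar>) powr (- s)) summable_on range (\<lambda>n. - int n)"
    by (subst summable_on_reindex) (use s in \<open>auto simp: o_def inj_def\<close>)
  ultimately have "(\<lambda>b::int. (1 + \<bar>real_of_int b\<bar>) powr (- s)) summable_on (range int \<union> range (\<lambda>n. - int n))"
    by (rule summable_on_union)
  moreover have "b \<in> range int \<union> range (\<lambda>n. - int n)" for b
    by (cases b rule: int_cases2) auto
  then have "range int \<union> range (\<lambda>n. - int n) = UNIV" by blast
  ultimately show ?thesis by simp
qed

text \<open>Grouped by \<open>b\<close>, the sum is dominated by a series with exponent 2/3 - 2 =
  -4/3. It serves as the majorant for the sums over forms below.\<close>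

lemma summable_on_forms:
  assumes sq: "\<nexists>m::int. D = m\<^sup>2" and D: "D > 0"
  shows "(\<lambda>Q. 1 / (1 + \<bar>real_of_int (fst (snd Q))\<bar>)\<^sup>2) summable_on forms D"
proof -
  let ?S = "\<lambda>b. {Q \<in> forms D. fst (snd Q) = b}"
  let ?g = "\<lambda>b::int. 1 / (1 + \<bar>real_of_int b\<bar>)\<^sup>2"
  have "(\<lambda>(b, Q). ?g b) summable_on (SIGMA b:UNIV. ?S b)"
  proof (rule summable_on_SigmaI)
    show "((\<lambda>Q. case (b, Q) of (b, Q) \<Rightarrow> ?g b) has_sum (real (card (?S b)) * ?g b)) (?S b)" for b
      using has_sum_finite[OF card_forms_middle(1)[OF sq D], of "\<lambda>_. ?g b"] by simp
    have "(\<lambda>b::int. 512 * real_of_int D * (1 + \<bar>real_of_int b\<bar>) powr (- (4/3))) summable_on UNIV"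
      by (intro summable_on_cmult_right summable_on_int_powr) auto
    then show "(\<lambda>b. real (card (?S b)) * ?g b) summable_on UNIV"
    proof (rule summable_on_comparison_test)
      fix b :: int
      have "real (card (?S b)) * ?g b \<le> 512 * real_of_int D * (1 + \<bar>real_of_int b\<bar>) powr (2/3) * ?g b"
        using card_forms_middle(2)[OF sq D] by (intro mult_right_mono) auto
      also have "\<dots> = 512 * real_of_int D * ((1 + \<bar>real_of_int b\<bar>) powr (2/3) * (1 + \<bar>real_of_int b\<bar>) powr (-2))"
        by (simp add: powr_minus_divide)
      finally show "real (card (?S b)) * ?g b \<le> 512 * real_of_int D * (1 + \<bar>real_of_int b\<bar>) powr (- (4/3))"
        by (simp flip: powr_add)
    qed auto
  qed auto
  then have "(\<lambda>p. ?g (fst (snd (snd p)))) summable_on (SIGMA b:UNIV. ?S b)"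
    by (rule summable_on_cong[THEN iffD1, rotated]) auto
  moreover have "bij_betw snd (SIGMA b:UNIV. ?S b) (forms D)"
    by (rule bij_betwI[where g = "\<lambda>Q. (fst (snd Q), Q)"]) auto
  ultimately show ?thesis
    using summable_on_reindex_bij_betw[of snd "SIGMA b:UNIV. ?S b" "forms D" "\<lambda>Q. ?g (fst (snd Q))"]
    by simp
qed

subsection \<open>The sum of the powers of the forms\<close>

lemma form_at_eq_geodesic_fun:
  "Re (form_at (a, b, c) z) = geodesic_fun (a, b, c) z - 2 * real_of_int a * (Im z)\<^sup>2"
  "Im (form_at (a, b, c) z) = Im z * (2 * real_of_int a * Re z + real_of_int b)"
  unfolding form_at_def geodesic_fun_def cmod_power2
  by (simp_all add: power2_eq_square algebra_simps)

text \<open>A polynomial identity once \<open>D = b\<^sup>2 - 4 * a * c\<close> is inserted. Read as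
  a right triangle with legs \<open>geodesic_fun Q z\<close> and \<open>sqrt D * Im z\<close>, it
  makes the argument of \<open>psi\<close> the square of a sine; for \<open>D > 0\<close> it also
  shows that \<open>form_at Q\<close> has no zero off the real line.\<close>

lemma norm_form_at:
  assumes "Q \<in> forms D"
  shows "(cmod (form_at Q z))\<^sup>2 = (geodesic_fun Q z)\<^sup>2 + real_of_int D * (Im z)\<^sup>2"
proof (cases Q)
  case (fields a b c)
  then have D: "D = b\<^sup>2 - 4 * a * c" using assms by (simp add: forms_def)
  show ?thesis
    unfolding fields cmod_power2 form_at_eq_geodesic_fun D
    by (simp add: geodesic_fun_def cmod_power2) algebra
qed

text \<open>The modulus of Q(z) bounds both \<open>geodesic_fun\<close> and the real part of Q(z),
  hence their difference, which is twice \<open>a * (Im z)\<^sup>2\<close>. The imaginary part then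
  bounds \<open>b\<close>. The summand 1 on the left is absorbed because
  \<open>\<bar>a\<bar> \<ge> 1\<close> forces \<open>(Im z)\<^sup>2\<close> to be at most the
  modulus.\<close>

lemma middle_coeff_le:
  assumes sq: "\<nexists>m::int. D = m\<^sup>2" and "D > 0" and "(a, b, c) \<in> forms D" and y: "Im z > 0"
  shows "1 + \<bar>real_of_int b\<bar> \<le> (1 / Im z + (2 * \<bar>Re z\<bar> + 1) / (Im z)\<^sup>2) * cmod (form_at (a, b, c) z)"
proof -
  let ?Q = "cmod (form_at (a, b, c) z)"
  have a: "1 \<le> \<bar>real_of_int a\<bar>" using form_coeff_nonzero[OF sq assms(3)] by linarith
  have "(geodesic_fun (a, b, c) z)\<^sup>2 \<le> ?Q\<^sup>2"
    using norm_form_at[OF assms(3)] assms(2) by simp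
  then have 1: "\<bar>geodesic_fun (a, b, c) z\<bar> \<le> ?Q" by (metis abs_le_square_iff abs_norm_cancel)
  have "\<bar>Re (form_at (a, b, c) z)\<bar> \<le> ?Q" by (rule abs_Re_le_cmod)
  with 1 have "\<bar>real_of_int a * (Im z)\<^sup>2\<bar> \<le> ?Q"
    unfolding form_at_eq_geodesic_fun by linarith
  then have aQ: "\<bar>real_of_int a\<bar> * (Im z)\<^sup>2 \<le> ?Q" by (simp add: abs_mult)
  have "1 * (Im z)\<^sup>2 \<le> \<bar>real_of_int a\<bar> * (Im z)\<^sup>2" using a by (intro mult_right_mono) auto
  then have yQ: "(Im z)\<^sup>2 \<le> ?Q" using aQ by simp
  have "\<bar>Im (form_at (a, b, c) z)\<bar> \<le> ?Q" by (rule abs_Im_le_cmod)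
  then have "Im z * \<bar>2 * real_of_int a * Re z + real_of_int b\<bar> \<le> ?Q"
    unfolding form_at_eq_geodesic_fun using y by (simp add: abs_mult)
  then have 2: "\<bar>2 * real_of_int a * Re z + real_of_int b\<bar> \<le> ?Q / Im z"
    using y by (simp add: field_simps)
  have "\<bar>real_of_int b\<bar> \<le> \<bar>2 * real_of_int a * Re z + real_of_int b\<bar> + 2 * (\<bar>real_of_int a\<bar> * \<bar>Re z\<bar>)"
    unfolding abs_mult[symmetric] by linarith
  also have "\<dots> \<le> ?Q / Im z + 2 * (?Q / (Im z)\<^sup>2 * \<bar>Re z\<bar>)"
    using 2 aQ y by (intro add_mono mult_left_mono mult_right_mono) (auto simp: field_simps)
  finally have 3: "\<bar>real_of_int b\<bar> \<le> ?Q / Im z + 2 * (?Q / (Im z)\<^sup>2 * \<bar>Re z\<bar>)" .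
  have "1 \<le> ?Q / (Im z)\<^sup>2" using yQ y by simp
  with 3 show "1 + \<bar>real_of_int b\<bar> \<le> (1 / Im z + (2 * \<bar>Re z\<bar> + 1) / (Im z)\<^sup>2) * ?Q"
    by (simp add: algebra_simps add_divide_distrib)
qed

lemma form_at_nonzero:
  assumes "\<nexists>m::int. D = m\<^sup>2" "D > 0" "Q \<in> forms D" "Im z \<noteq> 0"
  shows "form_at Q z \<noteq> 0"
  using norm_form_at[OF assms(3), of z] assms by (auto simp: add_nonneg_eq_0_iff)

text \<open>The point \<open>z\<close> enters only through \<open>M\<close>, so a single majorant
  serves a whole compact set, and small \<open>M\<close> high up in the half-plane gives
  decay.\<close>

lemma norm_inverse_form_at_le:
  assumes "\<nexists>m::int. D = m\<^sup>2" "D > 0" "Q \<in> forms D" "Im z > 0" "k \<ge> 2"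
    and M: "1 / Im z + (2 * \<bar>Re z\<bar> + 1) / (Im z)\<^sup>2 \<le> M"
  shows "norm (1 / form_at Q z ^ k) \<le> M ^ k * (1 / (1 + \<bar>real_of_int (fst (snd Q))\<bar>)\<^sup>2)"
proof -
  obtain a b c where Q: "Q = (a, b, c)" by (cases Q)
  have pos: "cmod (form_at Q z) > 0" using form_at_nonzero[OF assms(1-3)] assms(4) by simp
  have "1 + \<bar>real_of_int b\<bar> \<le> M * cmod (form_at Q z)"
    using middle_coeff_le[OF assms(1,2) assms(3)[unfolded Q] assms(4)] M pos
    unfolding Q by (meson mult_right_mono norm_ge_zero order_trans)
  then have "(1 + \<bar>real_of_int b\<bar>) ^ k \<le> M ^ k * cmod (form_at Q z) ^ k"
    unfolding power_mult_distrib[symmetric] by (rule power_mono) auto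
  moreover have "(1 + \<bar>real_of_int b\<bar>)\<^sup>2 \<le> (1 + \<bar>real_of_int b\<bar>) ^ k"
    using assms(5) by (intro power_increasing) auto
  ultimately have "(1 + \<bar>real_of_int b\<bar>)\<^sup>2 \<le> M ^ k * cmod (form_at Q z) ^ k" by linarith
  moreover have "(1 + \<bar>real_of_int b\<bar>)\<^sup>2 > 0"
    by (smt (verit) abs_ge_zero zero_less_power)
  ultimately show ?thesis using pos by (simp add: Q norm_divide norm_power field_simps)
qed

text \<open>This is \<open>f_form\<close> without its constant factor; see
  \<open>f_form_eq\<close>.\<close>

definition form_sum :: "nat \<Rightarrow> int \<Rightarrow> complex \<Rightarrow> complex" where
  "form_sum k D z = (\<Sum>\<^sub>\<infinity>Q\<in>forms D. 1 / form_at Q z ^ k)"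

lemma form_sum_uniform_limit:
  assumes "\<nexists>m::int. D = m\<^sup>2" "D > 0" "k \<ge> 2" "compact K" "\<And>z. z \<in> K \<Longrightarrow> Im z > 0"
  shows "uniform_limit K (\<lambda>X z. \<Sum>Q\<in>X. 1 / form_at Q z ^ k) (form_sum k D) (finite_subsets_at_top (forms D))"
proof -
  have "continuous_on K (\<lambda>z. 1 / Im z + (2 * \<bar>Re z\<bar> + 1) / (Im z)\<^sup>2)"
    using assms(5) by (intro continuous_intros) fastforce+
  then have "compact ((\<lambda>z. 1 / Im z + (2 * \<bar>Re z\<bar> + 1) / (Im z)\<^sup>2) ` K)"
    using assms(4) by (rule compact_continuous_image)
  then obtain M where M: "\<And>z. z \<in> K \<Longrightarrow> 1 / Im z + (2 * \<bar>Re z\<bar> + 1) / (Im z)\<^sup>2 \<le> M"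
    by (force dest!: compact_imp_bounded simp: bounded_iff abs_le_iff)
  show ?thesis
    unfolding form_sum_def
  proof (rule Weierstrass_m_test_general)
    show "norm (1 / form_at Q z ^ k) \<le> M ^ k * (1 / (1 + \<bar>real_of_int (fst (snd Q))\<bar>)\<^sup>2)"
      if "Q \<in> forms D" "z \<in> K" for Q z
      using that assms M by (intro norm_inverse_form_at_le)
    show "(\<lambda>Q. M ^ k * (1 / (1 + \<bar>real_of_int (fst (snd Q))\<bar>)\<^sup>2)) summable_on forms D"
      using assms by (intro summable_on_cmult_right summable_on_forms)
  qed
qed

lemma form_sum_abs_summable:
  assumes "\<nexists>m::int. D = m\<^sup>2" "D > 0" "k \<ge> 2" "Im z > 0"
  shows "(\<lambda>Q. norm (1 / form_at Q z ^ k)) summable_on forms D"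
proof (rule summable_on_comparison_test[rotated])
  show "norm (1 / form_at Q z ^ k)
      \<le> (1 / Im z + (2 * \<bar>Re z\<bar> + 1) / (Im z)\<^sup>2) ^ k * (1 / (1 + \<bar>real_of_int (fst (snd Q))\<bar>)\<^sup>2)"
    if "Q \<in> forms D" for Q
    using that assms by (intro norm_inverse_form_at_le) auto
  show "(\<lambda>Q. (1 / Im z + (2 * \<bar>Re z\<bar> + 1) / (Im z)\<^sup>2) ^ k
      * (1 / (1 + \<bar>real_of_int (fst (snd Q))\<bar>)\<^sup>2)) summable_on forms D"
    using assms by (intro summable_on_cmult_right summable_on_forms)
qed simp

lemma form_sum_holomorphic:
  assumes "\<nexists>m::int. D = m\<^sup>2" "D > 0" "k \<ge> 2"
  shows "form_sum k D holomorphic_on {z. Im z > 0}"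
proof -
  have op: "open {z. Im z > 0}" by (rule open_halfspace_Im_gt)
  have "\<exists>r>0. form_sum k D holomorphic_on ball z r" if z: "Im z > 0" for z
  proof -
    obtain r where r: "r > 0" "cball z r \<subseteq> {z. Im z > 0}"
      using op z by (metis mem_Collect_eq open_contains_cball)
    let ?f = "\<lambda>X z. \<Sum>Q\<in>X. 1 / form_at Q z ^ k"
    have hol: "(\<lambda>z. 1 / form_at Q z ^ k) holomorphic_on cball z r" if "Q \<in> forms D" for Q
    proof (rule holomorphic_on_divide)
      show "(\<lambda>z. form_at Q z ^ k) holomorphic_on cball z r"
        unfolding form_at_def case_prod_unfold by (intro holomorphic_intros)
      show "form_at Q w ^ k \<noteq> 0" if "w \<in> cball z r" for w
      proof -
        have "Im w > 0" using r(2) that by blast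
        then show ?thesis using form_at_nonzero[OF assms(1,2) \<open>Q \<in> forms D\<close>, of w] by auto
      qed
    qed simp
    have "?f X holomorphic_on cball z r" if "X \<subseteq> forms D" for X
      using hol that by (intro holomorphic_on_sum) auto
    then have "continuous_on (cball z r) (?f X) \<and> ?f X holomorphic_on ball z r"
      if "X \<subseteq> forms D" for X
      using that holomorphic_on_imp_continuous_on holomorphic_on_subset[OF _ ball_subset_cball] by blast
    then have ev: "\<forall>\<^sub>F X in finite_subsets_at_top (forms D).
        continuous_on (cball z r) (?f X) \<and> ?f X holomorphic_on ball z r"
      by (rule eventually_finite_subsets_at_top_weakI)
    have "uniform_limit (cball z r) ?f (form_sum k D) (finite_subsets_at_top (forms D))"
      using assms r by (intro form_sum_uniform_limit) auto
    from holomorphic_uniform_limit[OF ev this] have "form_sum k D holomorphic_on ball z r"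
      by auto
    then show ?thesis using r by blast
  qed
  then have "form_sum k D analytic_on {z. Im z > 0}"
    unfolding analytic_on_def by simp
  then show ?thesis by (rule analytic_imp_holomorphic)
qed

text \<open>Translation permutes the forms: Q(z + 1) is the value at z of
  [a, 2a + b, a + b + c].\<close>

lemma form_sum_periodic: "form_sum k D (z + 1) = form_sum k D z"
proof -
  have "bij_betw (\<lambda>(a, b, c). (a, 2 * a + b, a + b + c)) (forms D) (forms D)"
    by (rule bij_betwI[where g = "\<lambda>(a, b, c). (a, b - 2 * a, a - b + c)"])
       (auto simp: forms_def power2_eq_square algebra_simps)
  then have "form_sum k D z
      = (\<Sum>\<^sub>\<infinity>Q\<in>forms D. 1 / form_at ((\<lambda>(a, b, c). (a, 2 * a + b, a + b + c)) Q) z ^ k)"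
    unfolding form_sum_def by (rule infsum_reindex_bij_betw[symmetric])
  also have "\<dots> = form_sum k D (z + 1)"
    unfolding form_sum_def
    by (intro infsum_cong) (auto simp: form_at_def power2_eq_square algebra_simps)
  finally show ?thesis by simp
qed

text \<open>Q(-z) is the value at z of [a, -b, c]. Together with \<open>form_sum_cnj\<close> this
  identifies \<open>cnj (f (- cnj z))\<close> with \<open>f z\<close> in the integrand of
  \<open>nonhol_eichler\<close>.\<close>

lemma form_sum_reflect: "form_sum k D (- z) = form_sum k D z"
proof -
  have "bij_betw (\<lambda>(a, b, c). (a, - b, c)) (forms D) (forms D)"
    by (rule bij_betwI[where g = "\<lambda>(a, b, c). (a, - b, c)"]) (auto simp: forms_def)
  then have "form_sum k D z
      = (\<Sum>\<^sub>\<infinity>Q\<in>forms D. 1 / form_at ((\<lambda>(a, b, c). (a, - b, c)) Q) z ^ k)"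
    unfolding form_sum_def by (rule infsum_reindex_bij_betw[symmetric])
  also have "\<dots> = form_sum k D (- z)"
    unfolding form_sum_def by (intro infsum_cong) (auto simp: form_at_def)
  finally show ?thesis by simp
qed

lemma form_sum_cnj: "form_sum k D (cnj z) = cnj (form_sum k D z)"
  unfolding form_sum_def infsum_cnj[symmetric]
  by (intro infsum_cong) (auto simp: form_at_def)

text \<open>In this strip \<open>norm_inverse_form_at_le\<close> applies with
  \<open>M = 4 / Im z\<close>. The resulting decay is what removes the singularity at q = 0 and
  makes the constant Fourier coefficient vanish.\<close>

lemma form_sum_decay:
  assumes "\<nexists>m::int. D = m\<^sup>2" "D > 0" "k \<ge> 2"
  obtains B where "\<And>z. \<bar>Re z\<bar> \<le> 1 \<Longrightarrow> Im z \<ge> 1 \<Longrightarrow> norm (form_sum k D z) \<le> B / Im z"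
proof
  let ?S = "\<Sum>\<^sub>\<infinity>Q\<in>forms D. 1 / (1 + \<bar>real_of_int (fst (snd Q))\<bar>)\<^sup>2"
  fix z assume z: "\<bar>Re z\<bar> \<le> 1" "Im z \<ge> 1"
  let ?y = "Im z"
  have M: "1 / ?y + (2 * \<bar>Re z\<bar> + 1) / ?y\<^sup>2 \<le> 4 / ?y"
  proof -
    have "(2 * \<bar>Re z\<bar> + 1) / ?y\<^sup>2 \<le> 3 / ?y"
    proof (rule frac_le)
      have "?y * 1 \<le> ?y * ?y" using z by (intro mult_left_mono) auto
      then show "?y \<le> ?y\<^sup>2" by (simp add: power2_eq_square)
    qed (use z in auto)
    then show ?thesis by simp
  qed
  have "norm (form_sum k D z) \<le> (\<Sum>\<^sub>\<infinity>Q\<in>forms D. (4 / ?y) ^ k * (1 / (1 + \<bar>real_of_int (fst (snd Q))\<bar>)\<^sup>2))"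
    unfolding form_sum_def
  proof (rule norm_infsum_le)
    show "((\<lambda>Q. 1 / form_at Q z ^ k) has_sum (\<Sum>\<^sub>\<infinity>Q\<in>forms D. 1 / form_at Q z ^ k)) (forms D)"
      using assms z by (intro has_sum_infsum abs_summable_summable[OF form_sum_abs_summable]) auto
    have "(\<lambda>Q. (4 / ?y) ^ k * (1 / (1 + \<bar>real_of_int (fst (snd Q))\<bar>)\<^sup>2)) summable_on forms D"
      using assms by (intro summable_on_cmult_right summable_on_forms)
    then show "((\<lambda>Q. (4 / ?y) ^ k * (1 / (1 + \<bar>real_of_int (fst (snd Q))\<bar>)\<^sup>2)) has_sum
        (\<Sum>\<^sub>\<infinity>Q\<in>forms D. (4 / ?y) ^ k * (1 / (1 + \<bar>real_of_int (fst (snd Q))\<bar>)\<^sup>2))) (forms D)"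
      by (rule has_sum_infsum)
    show "norm (1 / form_at Q z ^ k) \<le> (4 / ?y) ^ k * (1 / (1 + \<bar>real_of_int (fst (snd Q))\<bar>)\<^sup>2)"
      if "Q \<in> forms D" for Q
      using norm_inverse_form_at_le[OF assms(1,2) that _ assms(3) M] z by linarith
  qed
  also have "\<dots> = (4 / ?y) ^ k * ?S" by (rule infsum_cmult_right') 
  also have "\<dots> \<le> 4 ^ k / ?y * ?S"
  proof (rule mult_right_mono)
    \<comment> \<open>Only one of the \<open>k\<close> factors \<open>1 / ?y\<close> is kept; the
      others are at most 1.\<close>
    have "?y ^ 1 \<le> ?y ^ k" using z assms by (intro power_increasing) auto
    then show "(4 / ?y) ^ k \<le> 4 ^ k / ?y" using z unfolding power_divide by (intro divide_left_mono) auto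
    show "?S \<ge> 0" by (rule infsum_nonneg) auto
  qed
  finally show "norm (form_sum k D z) \<le> 4 ^ k * ?S / ?y" by simp
qed

subsection \<open>Fourier expansion and iterated antiderivatives\<close>

lemma nome_nonzero: "nome z \<noteq> 0"
  by (simp add: nome_def)

lemma nome_add: "nome (z + w) = nome z * nome w"
  by (simp add: nome_def ring_distribs exp_add)

lemma norm_nome: "norm (nome z) = exp (- (2 * pi * Im z))"
  by (simp add: nome_def)

lemma norm_nome_less_1: "Im z > 0 \<Longrightarrow> norm (nome z) < 1"
  by (simp add: norm_nome)

lemma nome_Ln:
  assumes "q \<noteq> 0"
  shows "nome (- (\<i> * Ln q) / (2 * pi)) = q"
proof -
  have "2 * of_real pi * \<i> * (- (\<i> * Ln q) / (2 * pi)) = Ln q"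
    by (simp add: divide_simps)
  with assms show ?thesis unfolding nome_def by (metis exp_Ln)
qed

lemma nome_surj:
  assumes "q \<noteq> 0" "norm q < 1"
  shows "Im (- (\<i> * Ln q) / (2 * pi)) > 0"
proof -
  have "Im (- (\<i> * Ln q) / (2 * pi)) = - ln (norm q) / (2 * pi)" using assms by simp
  also have "\<dots> > 0" using assms by (intro divide_pos_pos) auto
  finally show ?thesis .
qed

lemma nome_eqD:
  assumes "nome z = nome w"
  obtains n :: int where "z = w + of_int n"
proof -
  obtain n :: int where *: "2 * of_real pi * \<i> * z = 2 * of_real pi * \<i> * w + of_int (2 * n) * pi * \<i>"
    using assms unfolding nome_def exp_eq by blast
  have "(2 * of_real pi * \<i>) * z = (2 * of_real pi * \<i>) * (w + of_int n)"
    unfolding ring_distribs using * by (simp add: algebra_simps)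
  then have "z = w + of_int n" by (subst (asm) mult_cancel_left) simp
  then show thesis by (rule that)
qed

lemma has_field_derivative_nome:
  "(nome has_field_derivative 2 * of_real pi * \<i> * nome z) (at z)"
  unfolding nome_def by (auto intro!: derivative_eq_intros)

lemma periodic_of_int:
  fixes f :: "complex \<Rightarrow> 'a"
  assumes "\<And>z. f (z + 1) = f z"
  shows "f (z + of_int n) = f z"
proof (induction n rule: int_induct[where k = 0])
  case (step1 i)
  then show ?case using assms[of "z + of_int i"] by (simp add: add.assoc)
next
  case (step2 i)
  then show ?case using assms[of "z + of_int (i - 1)"] by (simp add: add.assoc)
qed simp

text \<open>By periodicity \<open>f\<close> factors through \<open>nome\<close> as a function
  \<open>g\<close> on the punctured unit disc. Two branches of the logarithm, cut along opposite
  half-axes, show that \<open>g\<close> is holomorphic there. The decay gives it the value 0 at the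
  origin, and its Taylor coefficients are the \<open>a n\<close>.\<close>

lemma fourier_expansion:
  assumes hol: "f holomorphic_on {z. Im z > 0}"
    and per: "\<And>z. f (z + 1) = f z"
    and decay: "\<And>z. \<bar>Re z\<bar> \<le> 1 \<Longrightarrow> Im z \<ge> 1 \<Longrightarrow> norm (f z) \<le> B / Im z"
  obtains a where "a 0 = 0" "\<And>z. Im z > 0 \<Longrightarrow> (\<lambda>n. a n * nome z ^ n) sums f z"
proof -
  let ?w = "\<lambda>q. - (\<i> * Ln q) / (2 * pi)"
  define g where "g = (\<lambda>q. if q = 0 then 0 else f (?w q))"
  have g_nome: "g (nome z) = f z" for z
  proof -
    obtain n where "?w (nome z) = z + of_int n"
      using nome_eqD nome_Ln[OF nome_nonzero] by metis
    then show ?thesis using periodic_of_int[of f, OF per] nome_nonzero by (simp add: g_def)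
  qed
  have hol1: "g holomorphic_on (ball 0 1 - \<real>\<^sub>\<le>\<^sub>0)"
  proof (rule holomorphic_transform)
    have "(f \<circ> ?w) holomorphic_on (ball 0 1 - \<real>\<^sub>\<le>\<^sub>0)"
    proof (rule holomorphic_on_compose_gen[OF _ hol])
      show "?w holomorphic_on (ball 0 1 - \<real>\<^sub>\<le>\<^sub>0)"
        by (intro holomorphic_intros) auto
      show "?w ` (ball 0 1 - \<real>\<^sub>\<le>\<^sub>0) \<subseteq> {z. Im z > 0}"
      proof clarify
        fix q :: complex assume "q \<in> ball 0 1" "q \<notin> \<real>\<^sub>\<le>\<^sub>0"
        then have "q \<noteq> 0" "norm q < 1" by auto
        then show "0 < Im (?w q)" by (rule nome_surj)
      qed
    qed
    then show "(\<lambda>q. f (?w q)) holomorphic_on (ball 0 1 - \<real>\<^sub>\<le>\<^sub>0)" by (simp add: o_def)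
  qed (auto simp: g_def)
  \<comment> \<open>As \<open>nome (1 / 2) = - 1\<close>, this is a second right inverse of
    \<open>nome\<close>, now cut along the positive axis.\<close>
  let ?v = "\<lambda>q. ?w (- q) + 1 / 2"
  have v: "nome (?v q) = q" if "q \<noteq> 0" for q
  proof -
    have "nome (1 / 2) = - 1" by (simp add: nome_def)
    moreover have "nome (?w (- q)) = - q" using that by (intro nome_Ln) simp
    ultimately show ?thesis by (simp only: nome_add) simp
  qed
  have hol2: "g holomorphic_on {q \<in> ball 0 1. - q \<notin> \<real>\<^sub>\<le>\<^sub>0}"
  proof (rule holomorphic_transform)
    have "(f \<circ> ?v) holomorphic_on {q \<in> ball 0 1. - q \<notin> \<real>\<^sub>\<le>\<^sub>0}"
    proof (rule holomorphic_on_compose_gen[OF _ hol])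
      show "?v holomorphic_on {q \<in> ball 0 1. - q \<notin> \<real>\<^sub>\<le>\<^sub>0}"
        by (intro holomorphic_intros) auto
      show "?v ` {q \<in> ball 0 1. - q \<notin> \<real>\<^sub>\<le>\<^sub>0} \<subseteq> {z. Im z > 0}"
      proof clarify
        fix q :: complex assume "q \<in> ball 0 1" "- q \<notin> \<real>\<^sub>\<le>\<^sub>0"
        then have "- q \<noteq> 0" "norm (- q) < 1" by auto
        then have "0 < Im (?w (- q))" by (rule nome_surj)
        then show "0 < Im (?v q)" by (simp only: plus_complex.sel) simp
      qed
    qed
    then show "(\<lambda>q. f (?v q)) holomorphic_on {q \<in> ball 0 1. - q \<notin> \<real>\<^sub>\<le>\<^sub>0}" by (simp add: o_def)
    show "f (?v q) = g q" if "q \<in> {q \<in> ball 0 1. - q \<notin> \<real>\<^sub>\<le>\<^sub>0}" for q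
    proof -
      have "q \<noteq> 0" using that by auto
      then show ?thesis using g_nome[of "?v q"] v by simp
    qed
  qed
  have "open (ball 0 1 - \<real>\<^sub>\<le>\<^sub>0 :: complex set)"
    by (intro open_Diff) auto
  moreover have "open {q::complex \<in> ball 0 1. - q \<notin> \<real>\<^sub>\<le>\<^sub>0}"
  proof -
    have "{q::complex \<in> ball 0 1. - q \<notin> \<real>\<^sub>\<le>\<^sub>0} = ball 0 1 \<inter> uminus -` (- \<real>\<^sub>\<le>\<^sub>0)" by auto
    then show ?thesis by (auto intro!: open_Int open_vimage continuous_intros simp: open_Compl)
  qed
  ultimately have "g holomorphic_on ((ball 0 1 - \<real>\<^sub>\<le>\<^sub>0) \<union> {q \<in> ball 0 1. - q \<notin> \<real>\<^sub>\<le>\<^sub>0})"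
    using hol1 hol2 by (intro holomorphic_on_Un)
  moreover have "(ball 0 1 - \<real>\<^sub>\<le>\<^sub>0) \<union> {q \<in> ball 0 1. - q \<notin> \<real>\<^sub>\<le>\<^sub>0} = (ball 0 1 - {0} :: complex set)"
    by (auto simp: complex_nonpos_Reals_iff complex_eq_iff)
  ultimately have hol': "g holomorphic_on (ball 0 1 - {0})" by simp
  \<comment> \<open>Near 0 the chosen preimage of \<open>q\<close> has imaginary part at least 1,
    and the range of \<open>Im (Ln q)\<close> bounds its real part, so \<open>decay\<close> applies
    to it.\<close>
  have "(g \<longlongrightarrow> 0) (at 0)"
  proof (rule Lim_null_comparison)
    have "\<forall>\<^sub>F q in at 0. q \<in> ball 0 (exp (- (2 * pi))) - {0::complex}"
      by (intro eventually_at_in_open) auto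
    then show "\<forall>\<^sub>F q in at 0. norm (g q) \<le> B / (- ln (norm q) / (2 * pi))"
    proof eventually_elim
      case (elim q)
      then have q: "q \<noteq> 0" "norm q < exp (- (2 * pi))" by auto
      then have "ln (norm q) < - (2 * pi)" 
        by (metis exp_less_cancel_iff exp_ln zero_less_norm_iff)
      then have Im: "Im (?w q) \<ge> 1" using q by (simp add: field_simps)
      have Re: "\<bar>Re (?w q)\<bar> \<le> 1"
        using mpi_less_Im_Ln[OF q(1)] Im_Ln_le_pi[OF q(1)] by (simp add: field_simps abs_le_iff)
      have "Im (?w q) = - ln (norm q) / (2 * pi)" using q by simp
      then show ?case using decay[OF Re Im] q by (simp add: g_def)
    qed
    show "((\<lambda>q::complex. B / (- ln (norm q) / (2 * pi))) \<longlongrightarrow> 0) (at 0)"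
    proof -
      have "filterlim (\<lambda>q::complex. norm q) (at_right 0) (at 0)"
        by (auto simp: filterlim_at intro!: tendsto_eq_intros)
           (simp_all add: eventually_at_filter)
      moreover have "((\<lambda>r. B / (- ln r / (2 * pi))) \<longlongrightarrow> 0) (at_right 0)"
        by real_asymp
      ultimately show ?thesis by (rule filterlim_compose[rotated])
    qed
  qed
  then have "(g \<longlongrightarrow> g z) (at z within ball 0 1)" if "z \<in> {0}" for z
    using that by (simp add: g_def) (rule tendsto_within_subset[OF _ subset_UNIV])
  then have "g holomorphic_on ball 0 1"
    by (rule no_isolated_singularity'[OF _ hol']) simp_all
  then have sums: "(\<lambda>n. (deriv ^^ n) g 0 / fact n * (q - 0) ^ n) sums g q" if "q \<in> ball 0 1" for q
    using holomorphic_power_series that by blast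
  show ?thesis
  proof
    show "(deriv ^^ 0) g 0 / fact 0 = 0" by (simp add: g_def)
    show "(\<lambda>n. (deriv ^^ n) g 0 / fact n * nome z ^ n) sums f z" if "Im z > 0" for z
      using sums[of "nome z"] norm_nome_less_1[OF that] g_nome by simp
  qed
qed

text \<open>Every nonzero \<open>q\<close> in the unit disc is a value of \<open>nome\<close>, and
  at \<open>q = 0\<close> both series vanish because \<open>a 0 = b 0 = 0\<close>. The difference
  series is therefore zero on the disc, while a nonzero coefficient would isolate its zero at the
  origin.\<close>

lemma fourier_coeffs_unique:
  assumes "a 0 = 0" "\<And>z. Im z > 0 \<Longrightarrow> (\<lambda>n. a n * nome z ^ n) sums f z"
    and "b 0 = 0" "\<And>z. Im z > 0 \<Longrightarrow> (\<lambda>n. b n * nome z ^ n) sums f z"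
  shows "a = b"
proof (rule ext, rule ccontr)
  fix m assume m: "a m \<noteq> b m"
  have s: "(\<lambda>n. (a n - b n) * (q - 0) ^ n) sums 0" if "norm (q - 0) < 1" for q :: complex
  proof (cases "q = 0")
    case True
    then show ?thesis using powser_sums_zero[of "\<lambda>n. a n - b n"] assms by simp
  next
    case False
    from sums_diff[OF assms(2)[OF nome_surj] assms(4)[OF nome_surj], OF False _ False]
    show ?thesis using that nome_Ln[OF False] by (simp add: algebra_simps)
  qed
  have "m > 0" using m assms by (cases m) auto
  obtain s where "s > 0" "\<And>z::complex. z \<in> cball 0 s - {0} \<Longrightarrow> (\<lambda>_. 0::complex) z \<noteq> 0"
    by (rule powser_0_nonzero[where r = 1 and \<xi> = 0 and a = "\<lambda>n. a n - b n" and f = "\<lambda>_. 0" and m = m])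
       (use s m \<open>m > 0\<close> in auto)
  from this(2)[of "of_real s"] this(1) show False by auto
qed

lemma cusp_coeff_eqI:
  assumes "a 0 = 0" "\<And>z. Im z > 0 \<Longrightarrow> (\<lambda>n. a n * nome z ^ n) sums f z"
  shows "cusp_coeff f = a"
  unfolding cusp_coeff_def
proof (rule the_equality)
  show "a 0 = 0 \<and> (\<forall>z\<in>upper_half_plane. (\<lambda>n. a n * nome z ^ n) sums f z)"
    using assms by (simp add: upper_half_plane_def)
  show "b = a" if "b 0 = 0 \<and> (\<forall>z\<in>upper_half_plane. (\<lambda>n. b n * nome z ^ n) sums f z)" for b
    by (rule fourier_coeffs_unique[of b f a]) (use that assms in \<open>auto simp: upper_half_plane_def\<close>)
qed

section \<open>Iterated antiderivatives of the Fourier series\<close>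

text \<open>The \<open>j\<close>-fold antiderivative of the Fourier series; the term \<open>n = 0\<close> is harmless as \<open>a 0 = 0\<close>.\<close>

definition eichler :: "(nat \<Rightarrow> complex) \<Rightarrow> nat \<Rightarrow> complex \<Rightarrow> complex" where
  "eichler a j z = (\<Sum>n. a n / (2 * of_real pi * \<i> * of_nat n) ^ j * nome z ^ n)"

context
  fixes a :: "nat \<Rightarrow> complex"
  assumes a0: "a 0 = 0" and a_summable: "\<And>q. norm q < 1 \<Longrightarrow> summable (\<lambda>n. a n * q ^ n)"
begin

lemma norm_eichler_coeff_le: "norm (a n / (2 * of_real pi * \<i> * of_nat n) ^ j) \<le> norm (a n)"
proof (cases "n = 0")
  case False
  have "1 * 1 \<le> 2 * pi * real n" using False pi_ge_two by (intro mult_mono) auto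
  then have "1 \<le> (2 * pi * real n) ^ j" by (intro one_le_power) simp
  then show ?thesis by (simp add: norm_divide norm_power norm_mult divide_le_eq mult_le_cancel_left1)
qed (simp add: a0)

lemma eichler_abs_summable:
  assumes "norm q < 1"
  shows "summable (\<lambda>n. norm (a n * q ^ n))"
    and "summable (\<lambda>n. a n / (2 * of_real pi * \<i> * of_nat n) ^ j * q ^ n)"
proof -
  \<comment> \<open>A radius strictly between \<open>norm q\<close> and 1: convergence there gives
    absolute convergence at \<open>q\<close>.\<close>
  define K where "K = complex_of_real ((1 + norm q) / 2)"
  have K: "norm q < norm K" "norm K < 1" using assms by (auto simp: K_def norm_divide simp flip: of_real_add)
  show 1: "summable (\<lambda>n. norm (a n * q ^ n))"
    using powser_insidea[OF a_summable[OF K(2)] K(1)] .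
  show "summable (\<lambda>n. a n / (2 * of_real pi * \<i> * of_nat n) ^ j * q ^ n)"
    by (rule summable_comparison_test'[OF 1, of 0])
       (unfold norm_mult, intro mult_right_mono norm_eichler_coeff_le norm_ge_zero)
qed

lemma has_field_derivative_eichler:
  assumes "Im z > 0"
  shows "(eichler a (Suc j) has_field_derivative eichler a j z) (at z)"
proof -
  let ?c = "2 * of_real pi * \<i> :: complex"
  let ?b = "\<lambda>j n. a n / (?c * of_nat n) ^ j"
  define K where "K = complex_of_real ((1 + norm (nome z)) / 2)"
  have K: "norm (nome z) < norm K" "norm K < 1"
    using norm_nome_less_1[OF assms] by (auto simp: K_def norm_divide simp flip: of_real_add)
  have "((\<lambda>q. \<Sum>n. ?b (Suc j) n * q ^ n) has_field_derivative (\<Sum>n. diffs (?b (Suc j)) n * nome z ^ n)) (at (nome z))"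
    by (rule termdiffs_strong[OF eichler_abs_summable(2)[OF K(2)] K(1)])
  from DERIV_chain2[OF this has_field_derivative_nome]
  have "(eichler a (Suc j) has_field_derivative
      (\<Sum>n. diffs (?b (Suc j)) n * nome z ^ n) * (?c * nome z)) (at z)"
    by (simp add: eichler_def[abs_def])
  also have "(\<Sum>n. diffs (?b (Suc j)) n * nome z ^ n) * (?c * nome z)
      = (\<Sum>n. diffs (?b (Suc j)) n * nome z ^ n * (?c * nome z))"
    by (rule suminf_mult2[OF termdiff_converges[OF K(1) eichler_abs_summable(2)]]) (use K in auto)
  also have "\<dots> = (\<Sum>n. ?b j (Suc n) * nome z ^ Suc n)"
  proof (rule suminf_cong)
    fix n show "diffs (?b (Suc j)) n * nome z ^ n * (?c * nome z) = ?b j (Suc n) * nome z ^ Suc n"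
      unfolding diffs_def by (simp add: field_simps del: of_nat_Suc)
  qed
  \<comment> \<open>The series from differentiation starts at index 1; the summand at 0 may be added
    because \<open>a 0 = 0\<close>.\<close>
  also have "\<dots> = eichler a j z"
    unfolding eichler_def
    using suminf_split_head[OF eichler_abs_summable(2)[OF norm_nome_less_1[OF assms]], of j] a0 by simp
  finally show ?thesis .
qed

text \<open>With no constant term, one factor \<open>norm (nome z)\<close> can be split off each
  summand and the remaining powers bounded by powers of 1/2. Twice the sum of
  \<open>norm (a n * (1 / 2) ^ n)\<close> serves as \<open>M\<close> for every
  \<open>j\<close>.\<close>

lemma norm_eichler_le:
  "\<exists>M. \<forall>j z. norm (nome z) \<le> 1 / 2 \<longrightarrow> norm (eichler a j z) \<le> M * norm (nome z)"
proof (intro exI allI impI)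
  fix j z assume q: "norm (nome z) \<le> 1 / 2"
  let ?q = "norm (nome z)"
  have s: "summable (\<lambda>n. norm (a n * (1 / 2) ^ n))" by (intro eichler_abs_summable) auto
  have "norm (eichler a j z) \<le> (\<Sum>n. norm (a n * (1 / 2) ^ n) * (2 * ?q))"
    unfolding eichler_def
  proof (rule norm_suminf_le)
    fix n
    show "norm (a n / (2 * of_real pi * \<i> * of_nat n) ^ j * nome z ^ n) \<le> norm (a n * (1 / 2) ^ n) * (2 * ?q)"
    proof (cases n)
      case 0
      then show ?thesis by (simp add: a0)
    next
      case (Suc m)
      have "?q ^ n \<le> (1 / 2) ^ m * ?q" using q power_mono[OF q, of m] by (simp add: Suc mult_mono' mult.commute mult_right_mono)
      also have "\<dots> = (1 / 2) ^ n * (2 * ?q)" by (simp add: Suc)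
      finally have "norm (a n) * ?q ^ n \<le> norm (a n) * ((1 / 2) ^ n * (2 * ?q))" by (rule mult_left_mono) simp
      moreover have "norm (a n / (2 * of_real pi * \<i> * of_nat n) ^ j * nome z ^ n) \<le> norm (a n) * ?q ^ n"
        using norm_eichler_coeff_le[of n j] unfolding norm_mult norm_power by (intro mult_right_mono) auto
      ultimately show ?thesis by (simp add: norm_mult norm_power norm_divide mult.assoc)
    qed
    show "summable (\<lambda>n. norm (a n * (1 / 2) ^ n) * (2 * ?q))"
      using s by (rule summable_mult2)
  qed
  also have "\<dots> = (\<Sum>n. norm (a n * (1 / 2) ^ n)) * 2 * ?q"
    by (simp only: suminf_mult2[OF s, of "2 * ?q", symmetric] mult.assoc)
  finally show "norm (eichler a j z) \<le> (\<Sum>n. norm (a n * (1 / 2) ^ n)) * 2 * ?q" .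
qed

text \<open>Up a vertical ray \<open>nome\<close> decays exponentially, which beats the polynomial
  factor. This removes the boundary term at infinity in \<open>nonhol_eichler\<close>.\<close>

lemma eichler_tendsto_0:
  "((\<lambda>T. (z + \<i> * of_real T - t) ^ m * eichler a j (z + \<i> * of_real T)) \<longlongrightarrow> 0) at_top"
proof -
  obtain M where M: "\<And>z. norm (nome z) \<le> 1 / 2 \<Longrightarrow> norm (eichler a j z) \<le> M * norm (nome z)"
    using norm_eichler_le by blast
  have nome_T: "norm (nome (z + \<i> * of_real T)) = exp (- (2 * pi * (Im z + T)))" for T
    by (simp add: norm_nome)
  have "((\<lambda>T. exp (- (2 * pi * (Im z + T)))) \<longlongrightarrow> 0) at_top"
    by real_asymp
  then have "\<forall>\<^sub>F T in at_top. exp (- (2 * pi * (Im z + T))) < 1 / 2"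
    by (rule order_tendstoD) auto
  moreover have "\<forall>\<^sub>F T in at_top. (T::real) \<ge> 0" by (rule eventually_ge_at_top)
  ultimately have "\<forall>\<^sub>F T in at_top. norm ((z + \<i> * of_real T - t) ^ m * eichler a j (z + \<i> * of_real T))
      \<le> (norm (z - t) + T) ^ m * (M * exp (- (2 * pi * (Im z + T))))"
  proof eventually_elim
    case (elim T)
    have "norm (z + \<i> * of_real T - t) \<le> norm (z - t) + T"
      using norm_triangle_ineq[of "z - t" "\<i> * of_real T"] elim by (simp add: norm_mult algebra_simps)
    then show ?case
      unfolding norm_mult norm_power using M[of "z + \<i> * of_real T"] elim
      by (intro mult_mono power_mono) (auto simp: nome_T)
  qed
  moreover have "((\<lambda>T. (norm (z - t) + T) ^ m * (M * exp (- (2 * pi * (Im z + T))))) \<longlongrightarrow> 0) at_top"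
    by real_asymp
  ultimately show ?thesis by (rule Lim_null_comparison)
qed

end

text \<open>For a sequence with \<open>A (j + 1)' = A j\<close>, iterated integration by parts of \<open>(z - t)^m * A 0 z\<close>.\<close>

primrec parts :: "nat \<Rightarrow> (nat \<Rightarrow> complex \<Rightarrow> complex) \<Rightarrow> complex \<Rightarrow> complex \<Rightarrow> complex" where
  "parts 0 A t z = A 1 z"
| "parts (Suc m) A t z = (z - t) ^ Suc m * A 1 z - of_nat (Suc m) * parts m (\<lambda>j. A (Suc j)) t z"

lemma has_field_derivative_parts:
  assumes "\<And>j. (A (Suc j) has_field_derivative A j z) (at z)"
  shows "(parts m A t has_field_derivative (z - t) ^ m * A 0 z) (at z)"
  using assms
proof (induction m arbitrary: A)
  case 0
  then show ?case using 0[of 0] by (simp add: parts_def[abs_def])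
next
  case (Suc m)
  have IH: "(parts m (\<lambda>j. A (Suc j)) t has_field_derivative (z - t) ^ m * A 1 z) (at z)"
    using Suc.IH[of "\<lambda>j. A (Suc j)"] Suc.prems by simp
  have A: "(A 1 has_field_derivative A 0 z) (at z)" using Suc.prems[of 0] by simp
  show ?case
    unfolding parts.simps
    by (rule derivative_eq_intros IH A refl)+ (simp add: algebra_simps)
qed

text \<open>At z = t every boundary term with a positive power of z - t drops out. The surviving
  term is the source of (2k-2)! and of the holomorphic Eichler integral.\<close>

lemma parts_diagonal: "parts m A t t = (- 1) ^ m * fact m * A (Suc m) t"
  by (induction m arbitrary: A) (simp_all add: algebra_simps)

text \<open>Boundary terms at a fixed base point \<open>z\<close> depend polynomially on
  \<open>t\<close>, so they can be absorbed into the polynomial of the theorem.\<close>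

lemma parts_poly: "\<exists>p. degree p \<le> m \<and> (\<forall>t. poly p t = parts m A t z)"
proof (induction m arbitrary: A)
  case 0
  show ?case by (intro exI[of _ "[:A 1 z:]"]) simp
next
  case (Suc m)
  then obtain p where p: "degree p \<le> m" "\<And>t. poly p t = parts m (\<lambda>j. A (Suc j)) t z" by blast
  have "degree (smult (A 1 z) ([:z, - 1:] ^ Suc m) - smult (of_nat (Suc m)) p) \<le> Suc m"
  proof (intro degree_diff_le)
    have "degree ([:z, - 1:] ^ Suc m) \<le> Suc m"
      using degree_power_le[of "[:z, - 1:]" "Suc m"] by simp
    then show "degree (smult (A 1 z) ([:z, - 1:] ^ Suc m)) \<le> Suc m"
      using degree_smult_le le_trans by blast
    show "degree (smult (of_nat (Suc m)) p) \<le> Suc m"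
      using p(1) degree_smult_le[of "of_nat (Suc m)" p] by linarith
  qed
  then show ?case
    by (intro exI[of _ "smult (A 1 z) ([:z, - 1:] ^ Suc m) - smult (of_nat (Suc m)) p"])
       (auto simp: p(2) poly_power algebra_simps)
qed

lemma parts_tendsto_0:
  assumes "\<And>m j. ((\<lambda>T. (g T - t) ^ m * A (Suc j) (g T)) \<longlongrightarrow> 0) F"
  shows "((\<lambda>T. parts m A t (g T)) \<longlongrightarrow> 0) F"
  using assms
proof (induction m arbitrary: A)
  case 0
  then show ?case using 0[of 0 0] by simp
next
  case (Suc m)
  have "((\<lambda>T. parts m (\<lambda>j. A (Suc j)) t (g T)) \<longlongrightarrow> 0) F"
    by (rule Suc.IH) (rule Suc.prems)
  then show ?case
    using tendsto_diff[OF Suc.prems[of "Suc m" 0] tendsto_mult_right_zero[of _ F "of_nat (Suc m)"]]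
    by simp
qed

subsection \<open>The function psi as an integral of an even power of the sine\<close>

text \<open>The summand \<open>j = n\<close> vanishes because of \<open>x / 0 = 0\<close>; its contribution to the antiderivative is
  the linear term.\<close>

definition sin_prim :: "nat \<Rightarrow> complex \<Rightarrow> complex" where
  "sin_prim n z = (- 1 / 4) ^ n * ((- 1) ^ n * of_nat (2 * n choose n) * z +
     (\<Sum>j\<le>2 * n. (- 1) ^ j * of_nat (2 * n choose j) *
        (exp (2 * \<i> * (of_nat j - of_nat n) * z) / (2 * \<i> * (of_nat j - of_nat n)))))"

lemma sin_power2_exp:
  fixes z :: complex
  shows "(sin z)\<^sup>2 = - (exp (2 * \<i> * z) - 1)\<^sup>2 / (4 * exp (2 * \<i> * z))"
proof -
  define e where "e = exp (\<i> * z)"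
  have e0: "e \<noteq> 0" by (simp add: e_def)
  have "exp (- (\<i> * z)) = 1 / e" "exp (2 * \<i> * z) = e\<^sup>2"
    by (simp_all add: e_def exp_minus field_simps flip: exp_double) 
  then show ?thesis
    using e0 by (simp add: sin_exp_eq flip: e_def) (simp add: power2_eq_square field_simps)
qed

lemma sin_power_even:
  fixes z :: complex
  shows "sin z ^ (2 * n) = (- 1 / 4) ^ n * (\<Sum>j\<le>2 * n. (- 1) ^ j * of_nat (2 * n choose j) *
    exp (2 * \<i> * (of_nat j - of_nat n) * z))"
proof -
  define s where "s = exp (2 * \<i> * z)"
  have "sin z ^ (2 * n) = ((- 1 / 4) * ((1 - s)\<^sup>2 / s)) ^ n"
    unfolding power_mult sin_power2_exp s_def by (simp add: power2_commute[of 1])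
  also have "\<dots> = (- 1 / 4) ^ n * ((1 - s)\<^sup>2 / s) ^ n"
    by (rule power_mult_distrib)
  also have "((1 - s)\<^sup>2 / s) ^ n = (- s + 1) ^ (2 * n) / s ^ n"
    by (simp add: power_divide power_mult)
  also have "(- s + 1) ^ (2 * n) / s ^ n = (\<Sum>j\<le>2 * n. (- 1) ^ j * of_nat (2 * n choose j) * (s ^ j / s ^ n))"
    unfolding binomial_ring sum_divide_distrib
    by (intro sum.cong) (simp_all add: power_minus[of s] algebra_simps)
  also have "\<dots> = (\<Sum>j\<le>2 * n. (- 1) ^ j * of_nat (2 * n choose j) *
    exp (2 * \<i> * (of_nat j - of_nat n) * z))"
  proof (intro sum.cong refl)
    fix j
    have "s ^ j / s ^ n = exp (of_nat j * (2 * \<i> * z)) / exp (of_nat n * (2 * \<i> * z))"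
      by (simp add: s_def exp_of_nat_mult)
    also have "\<dots> = exp (2 * \<i> * (of_nat j - of_nat n) * z)"
      by (simp add: exp_diff[symmetric] algebra_simps)
    finally show "(- 1) ^ j * of_nat (2 * n choose j) * (s ^ j / s ^ n)
      = (- 1) ^ j * of_nat (2 * n choose j) * exp (2 * \<i> * (of_nat j - of_nat n) * z)" by simp
  qed
  finally show ?thesis .
qed

lemma has_field_derivative_sin_prim:
  "(sin_prim n has_field_derivative sin z ^ (2 * n)) (at z within S)"
proof -
  let ?c = "\<lambda>j. (- 1) ^ j * of_nat (2 * n choose j) :: complex"
  let ?e = "\<lambda>j. exp (2 * \<i> * (of_nat j - of_nat n) * z)"
  let ?d = "\<lambda>j. if j = n then 0 else ?c j * ?e j"
  have summand: "((\<lambda>z. ?c j * (exp (2 * \<i> * (of_nat j - of_nat n) * z) / (2 * \<i> * (of_nat j - of_nat n))))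
      has_field_derivative ?d j) (at z within S)" for j
  proof (cases "j = n")
    case False
    then have "(2 * \<i> * (of_nat j - of_nat n) :: complex) \<noteq> 0" by simp
    then show ?thesis using False by (auto intro!: derivative_eq_intros)
  qed simp
  have lin: "((\<lambda>z. (- 1) ^ n * of_nat (2 * n choose n) * z) has_field_derivative ?c n) (at z within S)"
    by (auto intro!: derivative_eq_intros)
  have "(sin_prim n has_field_derivative (- 1 / 4) ^ n * (?c n + (\<Sum>j\<le>2 * n. ?d j))) (at z within S)"
    unfolding sin_prim_def[abs_def] by (intro DERIV_cmult DERIV_add DERIV_sum summand lin)
  also have "?c n + (\<Sum>j\<le>2 * n. ?d j) = (\<Sum>j\<le>2 * n. ?c j * ?e j)"
  proof -
    have "(\<Sum>j\<le>2 * n. ?c j * ?e j) = ?c n * ?e n + (\<Sum>j\<in>{..2 * n} - {n}. ?c j * ?e j)"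
      by (rule sum.remove) auto
    moreover have "(\<Sum>j\<le>2 * n. ?d j) = ?d n + (\<Sum>j\<in>{..2 * n} - {n}. ?d j)"
      by (rule sum.remove) auto
    ultimately show ?thesis by simp
  qed
  finally show ?thesis by (simp only: sin_power_even)
qed

text \<open>The integrand is even, so its primitive normalised at 0 is odd. This lets the sign of
  \<open>geodesic_fun\<close> move inside the primitive.\<close>

lemma sin_prim_odd: "sin_prim n (- z) - sin_prim n 0 = - (sin_prim n z - sin_prim n 0)"
proof -
  have "((\<lambda>z. sin_prim n z + sin_prim n (- z)) has_field_derivative 0) (at z within UNIV)" for z
    by (rule derivative_eq_intros has_field_derivative_sin_prim
        DERIV_chain2[where f = "sin_prim n" and g = uminus] refl)+ simp
  then obtain c where "\<And>z. sin_prim n z + sin_prim n (- z) = c"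
    using has_field_derivative_zero_constant[of UNIV "\<lambda>z. sin_prim n z + sin_prim n (- z)"] by auto
  from this[of z] this[of 0] show ?thesis by (simp add: algebra_simps)
qed

lemma exp_2i_add_pi:
  "exp (2 * \<i> * (of_nat j - of_nat n) * (z + of_int m * of_real pi)) = exp (2 * \<i> * (of_nat j - of_nat n) * z)"
  unfolding exp_eq by (rule exI[of _ "(int j - int n) * m"]) (simp add: algebra_simps)

text \<open>The exponentials have period \<pi>, so only the linear term sees the shift. The constant
  produced is the price of changing the branch of the logarithm.\<close>

lemma sin_prim_shift:
  "sin_prim n (z + of_int m * of_real pi) =
     sin_prim n z + (- 1 / 4) ^ n * ((- 1) ^ n * of_nat (2 * n choose n) * (of_int m * of_real pi))"
  unfolding sin_prim_def exp_2i_add_pi by (simp add: algebra_simps)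

lemma has_integral_sin_power:
  assumes "0 \<le> \<theta>"
  shows "((\<lambda>t. complex_of_real (sin t ^ (2 * n))) has_integral sin_prim n (of_real \<theta>) - sin_prim n 0) {0..\<theta>}"
proof -
  have "((\<lambda>x. sin_prim n (of_real x)) has_vector_derivative complex_of_real (sin x ^ (2 * n))) (at x within {0..\<theta>})" for x
    using has_vector_derivative_real_field[OF has_field_derivative_sin_prim[of n "of_real x" UNIV]]
    by (simp add: sin_of_real flip: of_real_power)
  from fundamental_theorem_of_calculus[OF assms this] show ?thesis by simp
qed

text \<open>Substitute \<open>u = (sin x)\<^sup>2\<close>: the factor \<open>cos x\<close> from the
  differential cancels \<open>(1 - u) powr (- 1 / 2)\<close>. The bound
  \<open>\<theta> < pi / 2\<close> keeps \<open>u\<close> away from the singularity at 1.\<close>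

lemma psi_sin:
  assumes "k \<ge> 2" "0 \<le> \<theta>" "\<theta> < pi / 2"
  shows "of_real (psi k ((sin \<theta>)\<^sup>2)) = sin_prim (k - 1) (of_real \<theta>) - sin_prim (k - 1) 0"
proof -
  define f where "f = (\<lambda>u::real. u powr (real k - 3 / 2) * (1 - u) powr (- 1 / 2))"
  have mono: "sin x \<le> sin \<theta>" if "0 \<le> x" "x \<le> \<theta>" for x
    using that assms by (intro sin_monotone_2pi_le) auto
  have cos: "cos x > 0" if "0 \<le> x" "x \<le> \<theta>" for x
    using that assms by (intro cos_gt_zero_pi) auto
  have s0: "sin x \<ge> 0" if "0 \<le> x" "x \<le> \<theta>" for x
    using that assms by (intro sin_ge_zero) auto
  have "(sin \<theta>)\<^sup>2 < 1"
    using cos[of \<theta>] assms sin_cos_squared_add[of \<theta>] by (smt (verit) zero_less_power)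
  then have cont: "continuous_on {0..(sin \<theta>)\<^sup>2} f"
    unfolding f_def using assms(1)
    by (intro continuous_on_mult continuous_on_powr' continuous_intros) auto
  have "((\<lambda>x. (2 * sin x * cos x) *\<^sub>R f ((sin x)\<^sup>2)) has_integral (integral {(sin 0)\<^sup>2..(sin \<theta>)\<^sup>2} f)) {0..\<theta>}"
  proof (rule has_integral_substitution[OF assms(2) _ _ cont])
    show "((\<lambda>x. (sin x)\<^sup>2) has_real_derivative 2 * sin x * cos x) (at x within {0..\<theta>})" for x :: real
      by (auto intro!: derivative_eq_intros)
    show "(\<lambda>x. (sin x)\<^sup>2) ` {0..\<theta>} \<subseteq> {0..(sin \<theta>)\<^sup>2}"
      using mono s0 by (auto intro!: power_mono)
  qed auto
  then have "((\<lambda>x. (2 * sin x * cos x) * f ((sin x)\<^sup>2)) has_integral 2 * psi k ((sin \<theta>)\<^sup>2)) {0..\<theta>}"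
    by (simp add: psi_def f_def)
  \<comment> \<open>Where \<open>sin x = 0\<close> both sides vanish, as
    \<open>2 * (k - 1) > 0\<close>; elsewhere the base of \<open>powr\<close> is positive.\<close>
  moreover have "(2 * sin x * cos x) * f ((sin x)\<^sup>2) = 2 * sin x ^ (2 * (k - 1))" if "x \<in> {0..\<theta>}" for x
  proof (cases "sin x = 0")
    case True
    then show ?thesis using assms(1) by simp
  next
    case False
    then have s: "sin x > 0" using s0[of x] that by simp
    have c: "cos x > 0" using cos that by simp
    have "1 - (sin x)\<^sup>2 = cos x powr 2" "(sin x)\<^sup>2 = sin x powr 2"
      using c s by (simp_all add: cos_squared_eq)
    then have "f ((sin x)\<^sup>2) = sin x powr (2 * (real k - 3 / 2)) * cos x powr (- 1)"
      by (simp only: f_def powr_powr) simp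
    also have "\<dots> = sin x powr (real (2 * (k - 1)) - 1) / cos x"
      using assms(1) c by (simp add: powr_minus_divide of_nat_diff algebra_simps)
    also have "\<dots> = sin x ^ (2 * (k - 1)) / sin x / cos x"
      unfolding powr_diff powr_realpow[OF s] using s by simp
    finally show ?thesis using s c by simp
  qed
  ultimately have "((\<lambda>x. 2 * sin x ^ (2 * (k - 1))) has_integral 2 * psi k ((sin \<theta>)\<^sup>2)) {0..\<theta>}"
    by (rule has_integral_eq[rotated])
  from has_integral_mult_right[OF this, of "1 / 2"]
  have "((\<lambda>x. sin x ^ (2 * (k - 1))) has_integral psi k ((sin \<theta>)\<^sup>2)) {0..\<theta>}"
    by simp
  from has_integral_of_real[OF this] has_integral_sin_power[OF assms(2), of "k - 1"]
  show ?thesis by (rule has_integral_unique)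
qed

text \<open>Taylor's bound gives \<theta> - sin \<theta> \<le> \<open>\<theta> ^ 3 / 6\<close>,
  which is at most 2\<theta>/3 because \<theta> \<le> \<pi>/2 < 2.\<close>

lemma le_3_sin:
  assumes "0 \<le> \<theta>" "\<theta> \<le> pi / 2"
  shows "\<theta> \<le> 3 * sin \<theta>"
proof -
  have "\<bar>sin \<theta> - \<theta>\<bar> \<le> inverse 6 * \<bar>\<theta>\<bar> ^ 3"
    using Maclaurin_sin_bound[of \<theta> 3] by (simp add: numeral_3_eq_3 sin_coeff_def fact_numeral)
  then have "\<theta> - sin \<theta> \<le> \<theta> ^ 3 / 6"
    using assms abs_ge_minus_self[of "sin \<theta> - \<theta>"] by simp
  moreover have "\<theta> ^ 3 \<le> 4 * \<theta>"
  proof -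
    have "\<theta> * \<theta> \<le> 2 * 2" using assms pi_half_less_two by (intro mult_mono) auto
    then show ?thesis using assms mult_right_mono[of "\<theta> * \<theta>" 4 \<theta>] by (simp add: power3_eq_cube)
  qed
  ultimately show ?thesis by linarith
qed

text \<open>On the interval of length \<theta> the integrand is at most its value at \<theta>, and
  the length is at most \<open>3 * sin \<theta>\<close>. This extra factor of the sine is needed for
  the summability of \<open>F_term\<close>.\<close>

lemma norm_sin_prim_le:
  assumes "0 \<le> \<theta>" "\<theta> < pi / 2"
  shows "norm (sin_prim n (of_real \<theta>) - sin_prim n 0) \<le> 3 * sin \<theta> ^ (2 * n + 1)"
proof -
  have sin0: "sin \<theta> \<ge> 0" using assms by (intro sin_ge_zero) auto
  have "norm (sin_prim n (of_real \<theta>) - sin_prim n 0) \<le> sin \<theta> ^ (2 * n) * measure lborel (cbox 0 \<theta>)"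
  proof (rule has_integral_bound)
    show "((\<lambda>t. complex_of_real (sin t ^ (2 * n))) has_integral sin_prim n (of_real \<theta>) - sin_prim n 0) (cbox 0 \<theta>)"
      using has_integral_sin_power[OF assms(1)] by simp
    show "norm (complex_of_real (sin x ^ (2 * n))) \<le> sin \<theta> ^ (2 * n)" if "x \<in> cbox 0 \<theta>" for x
    proof -
      have "0 \<le> sin x" "sin x \<le> sin \<theta>"
        using that assms by (auto intro!: sin_ge_zero sin_monotone_2pi_le)
      then show ?thesis by (simp add: norm_power power_mono)
    qed
  qed (use sin0 in simp)
  also have "\<dots> \<le> sin \<theta> ^ (2 * n) * (3 * sin \<theta>)"
    using le_3_sin[of \<theta>] assms sin0 by (intro mult_left_mono) auto
  finally show ?thesis by (simp add: algebra_simps)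
qed

subsection \<open>Primitives attached to a single form\<close>

text \<open>A logarithm of the quotient \<mu> of the overview, holomorphic on both half-planes since
  the cuts lie on the real axis.\<close>

definition log_ratio :: "real \<Rightarrow> real \<Rightarrow> complex \<Rightarrow> complex" where
  "log_ratio \<alpha> \<beta> z = Ln (z - of_real \<alpha>) - Ln (z - of_real \<beta>)"

lemma nonreal_diff:
  assumes "Im z \<noteq> 0"
  shows "z - of_real \<alpha> \<noteq> 0" "z - of_real \<alpha> \<notin> \<real>\<^sub>\<le>\<^sub>0"
  using assms by (auto simp: complex_eq_iff complex_nonpos_Reals_iff)

lemma exp_log_ratio:
  assumes "Im z \<noteq> 0"
  shows "exp (log_ratio \<alpha> \<beta> z) = (z - of_real \<alpha>) / (z - of_real \<beta>)"
  using nonreal_diff[OF assms] by (simp add: log_ratio_def exp_diff)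

lemma has_field_derivative_log_ratio:
  assumes "Im z \<noteq> 0"
  shows "(log_ratio \<alpha> \<beta> has_field_derivative
    of_real (\<alpha> - \<beta>) / ((z - of_real \<alpha>) * (z - of_real \<beta>))) (at z)"
proof -
  have "(log_ratio \<alpha> \<beta> has_field_derivative 1 / (z - of_real \<alpha>) - 1 / (z - of_real \<beta>)) (at z)"
    unfolding log_ratio_def[abs_def]
    by (rule derivative_eq_intros nonreal_diff[OF assms] refl)+ (simp add: field_simps)
  also have "1 / (z - of_real \<alpha>) - 1 / (z - of_real \<beta>)
      = of_real (\<alpha> - \<beta>) / ((z - of_real \<alpha>) * (z - of_real \<beta>))"
    using nonreal_diff(1)[OF assms] by (simp add: field_simps)
  finally show ?thesis .
qed

text \<open>The two-variable function of the overview: \<open>t\<close> stands for \<tau> and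
  \<open>z\<close> replaces \<open>cnj \<tau>\<close>.\<close>

definition form_prim :: "nat \<Rightarrow> real \<Rightarrow> real \<Rightarrow> real \<Rightarrow> complex \<Rightarrow> complex \<Rightarrow> complex" where
  "form_prim n a \<alpha> \<beta> t z = (of_real a * (t - of_real \<alpha>) * (t - of_real \<beta>)) ^ n *
     sin_prim n ((log_ratio \<alpha> \<beta> t - log_ratio \<alpha> \<beta> z) / (2 * \<i>))"

lemma form_prim_diagonal:
  "form_prim n a \<alpha> \<beta> t t = (of_real a * (t - of_real \<alpha>) * (t - of_real \<beta>)) ^ n * sin_prim n 0"
  by (simp add: form_prim_def)

text \<open>Exponentiating 2i times the angle gives the cross-ratio of t, z, \<alpha>, \<beta>, and
  the cross-ratio minus 1 has numerator (\<alpha> - \<beta>)(t - z). Taking n-th powers trades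
  \<open>Q(t)^n\<close> times the even sine power for \<open>(t - z)^(2n) Q(z)^(-n)\<close>; the
  derivative of \<open>log_ratio\<close> supplies one more 1/Q(z).\<close>

lemma sin_log_ratio_square:
  assumes "a \<noteq> 0" "Im t \<noteq> 0" "Im z \<noteq> 0"
  shows "of_real a * (t - of_real \<alpha>) * (t - of_real \<beta>) *
      (sin ((log_ratio \<alpha> \<beta> t - log_ratio \<alpha> \<beta> z) / (2 * \<i>)))\<^sup>2
    = - (of_real (a * (\<alpha> - \<beta>)))\<^sup>2 / 4 * (t - z)\<^sup>2 / (of_real a * (z - of_real \<alpha>) * (z - of_real \<beta>))"
proof -
  let ?A = "t - of_real \<alpha>" and ?B = "t - of_real \<beta>" and ?C = "z - of_real \<alpha>" and ?D = "z - of_real \<beta>"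
  note nz = nonreal_diff(1)[OF assms(2), of \<alpha>] nonreal_diff(1)[OF assms(2), of \<beta>]
    nonreal_diff(1)[OF assms(3), of \<alpha>] nonreal_diff(1)[OF assms(3), of \<beta>]
  have s: "exp (2 * \<i> * ((log_ratio \<alpha> \<beta> t - log_ratio \<alpha> \<beta> z) / (2 * \<i>))) = (?A * ?D) / (?B * ?C)"
    using assms by (simp add: exp_diff exp_log_ratio)
  have s1: "(?A * ?D) / (?B * ?C) - 1 = of_real (\<alpha> - \<beta>) * (t - z) / (?B * ?C)"
  proof -
    have "?A * ?D - ?B * ?C = of_real (\<alpha> - \<beta>) * (t - z)" by (simp add: algebra_simps)
    then show ?thesis using nz by (simp add: divide_simps)
  qed
  have "- (x / (B * C))\<^sup>2 / (4 * ((A * E) / (B * C))) = - x\<^sup>2 / (4 * A * B * C * E)"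
    if "A \<noteq> 0" "B \<noteq> 0" "C \<noteq> 0" "E \<noteq> 0" for x A B C E :: complex
    using that by (simp add: divide_simps power2_eq_square)
  then have eq: "(sin ((log_ratio \<alpha> \<beta> t - log_ratio \<alpha> \<beta> z) / (2 * \<i>)))\<^sup>2
      = - (of_real (\<alpha> - \<beta>) * (t - z))\<^sup>2 / (4 * ?A * ?B * ?C * ?D)"
    unfolding sin_power2_exp s s1 using nz by blast
  have gen: "c * A * B * (- (d * x)\<^sup>2 / (4 * A * B * C * E)) = - (c * d)\<^sup>2 / 4 * x\<^sup>2 / (c * C * E)"
    if "c \<noteq> 0" "A \<noteq> 0" "B \<noteq> 0" "C \<noteq> 0" "E \<noteq> 0" for c d x A B C E :: complex
    using that by (simp add: divide_simps power2_eq_square)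
  show ?thesis
    unfolding eq of_real_mult by (rule gen) (use nz assms(1) in auto)
qed

lemma has_field_derivative_form_prim:
  assumes "a \<noteq> 0" "Im t \<noteq> 0" "Im z \<noteq> 0"
  shows "(form_prim n a \<alpha> \<beta> t has_field_derivative
    (- (of_real (a * (\<alpha> - \<beta>)))\<^sup>2 / 4) ^ n * (\<i> / 2 * of_real (a * (\<alpha> - \<beta>))) *
    ((t - z) ^ (2 * n) / (of_real a * (z - of_real \<alpha>) * (z - of_real \<beta>)) ^ Suc n)) (at z)"
proof -
  let ?q = "\<lambda>z. of_real a * (z - of_real \<alpha>) * (z - of_real \<beta>)"
  let ?\<theta> = "\<lambda>z. (log_ratio \<alpha> \<beta> t - log_ratio \<alpha> \<beta> z) / (2 * \<i>)"
  let ?\<delta> = "of_real (a * (\<alpha> - \<beta>)) :: complex"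
  let ?L = "of_real (\<alpha> - \<beta>) / ((z - of_real \<alpha>) * (z - of_real \<beta>))"
  have deriv: "((\<lambda>z. ?q t ^ n * sin_prim n (?\<theta> z)) has_field_derivative
      ?q t ^ n * (sin (?\<theta> z) ^ (2 * n) * (- ?L / (2 * \<i>)))) (at z)"
  proof (rule DERIV_cmult, rule DERIV_chain2[OF has_field_derivative_sin_prim])
    show "(?\<theta> has_field_derivative - ?L / (2 * \<i>)) (at z)"
      by (rule derivative_eq_intros has_field_derivative_log_ratio[OF assms(3)] refl)+ simp_all
  qed
  have L: "- ?L / (2 * \<i>) = \<i> / 2 * ?\<delta> / ?q z"
  proof -
    have "- x / (2 * \<i>) = \<i> / 2 * x" for x :: complex
      by (simp add: divide_eq_eq algebra_simps)
    moreover have "?\<delta> / ?q z = ?L" using assms(1) by simp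
    ultimately show ?thesis by (simp only: times_divide_eq_right[symmetric])
  qed
  have "?q t ^ n * (sin (?\<theta> z) ^ (2 * n) * (- ?L / (2 * \<i>)))
      = (?q t * (sin (?\<theta> z))\<^sup>2) ^ n * (- ?L / (2 * \<i>))"
    by (simp add: power_mult_distrib power_mult)
  also have "\<dots> = (- ?\<delta>\<^sup>2 / 4) ^ n * (t - z) ^ (2 * n) / ?q z ^ n * (\<i> / 2 * ?\<delta> / ?q z)"
    unfolding sin_log_ratio_square[OF assms] L
    by (simp only: power_mult_distrib power_divide power_mult)
  also have "\<dots> = (- ?\<delta>\<^sup>2 / 4) ^ n * (\<i> / 2 * ?\<delta>) * ((t - z) ^ (2 * n) / ?q z ^ Suc n)"
  proof -
    have "X * Y / R ^ n * (c / R) = X * c * (Y / R ^ Suc n)" for c X Y R :: complex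
      by (simp add: mult_ac)
    then show ?thesis .
  qed
  finally show ?thesis using deriv by (simp only: form_prim_def[abs_def])
qed

text \<open>The exponential is \<open>\<mu>(t)^(j - n)\<close>; its poles at \<alpha> or \<beta> are
  cancelled by the n-th power of the form, leaving a polynomial in t of degree 2n.\<close>

lemma form_power_exp_log_ratio:
  assumes "Im t \<noteq> 0" "j \<le> 2 * n"
  shows "((t - of_real \<alpha>) * (t - of_real \<beta>)) ^ n * exp ((of_nat j - of_nat n) * log_ratio \<alpha> \<beta> t)
    = (t - of_real \<alpha>) ^ j * (t - of_real \<beta>) ^ (2 * n - j)"
proof -
  define A where "A = Ln (t - of_real \<alpha>)"
  define B where "B = Ln (t - of_real \<beta>)"
  have e: "t - of_real \<alpha> = exp A" "t - of_real \<beta> = exp B"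
    using nonreal_diff(1)[OF assms(1)] by (auto simp: A_def B_def)
  have L: "log_ratio \<alpha> \<beta> t = A - B" by (simp add: log_ratio_def A_def B_def)
  have "of_nat n * (A + B) + (of_nat j - of_nat n) * (A - B) = of_nat j * A + of_nat (2 * n - j) * B"
    using assms(2) by (simp add: of_nat_diff algebra_simps)
  then have "exp (of_nat n * (A + B)) * exp ((of_nat j - of_nat n) * (A - B))
    = exp (of_nat j * A) * exp (of_nat (2 * n - j) * B)"
    by (simp only: exp_add[symmetric])
  then show ?thesis
    unfolding L e exp_of_nat_mult exp_add .
qed

text \<open>The exponential terms separate into a polynomial in \<open>t\<close> times a function of
  \<open>z\<close>. The linear term of \<open>sin_prim\<close> contains
  \<open>log_ratio \<alpha> \<beta> t\<close>, which cancels only in a difference; \<open>C\<close>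
  in the proof is what remains of it.\<close>

lemma form_prim_diff_poly:
  "\<exists>p. degree p \<le> 2 * n \<and> (\<forall>t. Im t \<noteq> 0 \<longrightarrow>
     poly p t = form_prim n a \<alpha> \<beta> t z - form_prim n a \<alpha> \<beta> t w)"
proof -
  let ?l = "log_ratio \<alpha> \<beta>"
  let ?c = "\<lambda>j. (- 1) ^ j * of_nat (2 * n choose j) / (2 * \<i> * (of_nat j - of_nat n)) :: complex"
  let ?P = "[:- of_real \<alpha>, 1:] :: complex poly" and ?R = "[:- of_real \<beta>, 1:] :: complex poly"
  define C where "C = (- 1) ^ n * of_nat (2 * n choose n) * ((?l w - ?l z) / (2 * \<i>))"
  define p where "p = smult ((- 1 / 4) ^ n * of_real a ^ n) (smult C (?P ^ n * ?R ^ n) +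
    (\<Sum>j\<le>2 * n. smult (?c j * (exp (- (of_nat j - of_nat n) * ?l z) - exp (- (of_nat j - of_nat n) * ?l w)))
      (?P ^ j * ?R ^ (2 * n - j))))"
  have d: "degree (?P ^ i * ?R ^ j) \<le> i + j" for i j
    using degree_mult_le[of "?P ^ i" "?R ^ j"] degree_power_le[of ?P i] degree_power_le[of ?R j] by simp
  have "degree p \<le> 2 * n"
    unfolding p_def
    by (intro order_trans[OF degree_smult_le] degree_add_le degree_sum_le order_trans[OF d]) auto
  moreover have "poly p t = form_prim n a \<alpha> \<beta> t z - form_prim n a \<alpha> \<beta> t w" if "Im t \<noteq> 0" for t
  proof -
    let ?q = "(t - of_real \<alpha>) * (t - of_real \<beta>)"
    have ex: "exp (2 * \<i> * (of_nat j - of_nat n) * ((?l t - ?l z) / (2 * \<i>)))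
        = exp ((of_nat j - of_nat n) * ?l t) * exp (- (of_nat j - of_nat n) * ?l z)" for j z
    proof -
      have "2 * \<i> * c * (x / (2 * \<i>)) = c * x" for c x :: complex
        by (simp add: divide_simps mult_ac)
      then show ?thesis by (simp only: exp_add[symmetric]) (simp add: algebra_simps)
    qed
    have fp: "form_prim n a \<alpha> \<beta> t z = (- 1 / 4) ^ n * of_real a ^ n *
        ((- 1) ^ n * of_nat (2 * n choose n) * ((?l t - ?l z) / (2 * \<i>)) * ?q ^ n +
         (\<Sum>j\<le>2 * n. ?c j * exp (- (of_nat j - of_nat n) * ?l z) *
            ((t - of_real \<alpha>) ^ j * (t - of_real \<beta>) ^ (2 * n - j))))" for z
    proof -
      have "(\<Sum>j\<le>2 * n. ?c j * exp (- (of_nat j - of_nat n) * ?l z) *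
            ((t - of_real \<alpha>) ^ j * (t - of_real \<beta>) ^ (2 * n - j)))
          = ?q ^ n * (\<Sum>j\<le>2 * n. (- 1) ^ j * of_nat (2 * n choose j) *
        (exp (2 * \<i> * (of_nat j - of_nat n) * ((?l t - ?l z) / (2 * \<i>))) / (2 * \<i> * (of_nat j - of_nat n))))"
        unfolding ex sum_distrib_left
        by (intro sum.cong refl) (simp add: form_power_exp_log_ratio[OF that, symmetric])
      moreover have "(of_real a * (t - of_real \<alpha>) * (t - of_real \<beta>)) ^ n = of_real a ^ n * ?q ^ n"
        by (simp add: power_mult_distrib)
      ultimately show ?thesis
        unfolding form_prim_def sin_prim_def by (simp only: distrib_left mult_ac)
    qed
    show ?thesis
      unfolding fp p_def C_def power_mult_distrib[of "t - of_real \<alpha>"]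
      by (simp add: poly_sum poly_power algebra_simps sum_subtractf diff_divide_distrib)
  qed
  ultimately show ?thesis by blast
qed

text \<open>The arctangent is an argument of w up to a multiple of \<pi>, and the factor 2 makes
  this ambiguity harmless.\<close>

lemma exp_2i_arctan:
  assumes "Re w \<noteq> 0"
  shows "exp (2 * \<i> * of_real (arctan (Im w / Re w))) = w / cnj w"
proof -
  define \<theta> where "\<theta> = arctan (Im w / Re w)"
  have c: "cos \<theta> \<noteq> 0" unfolding \<theta>_def by simp
  have "tan \<theta> = Im w / Re w" by (simp add: \<theta>_def tan_arctan)
  then have "Im w * cos \<theta> = Re w * sin \<theta>" using c assms by (simp add: tan_def field_simps)
  then have w: "w * of_real (cos \<theta>) = of_real (Re w) * cis \<theta>"
    by (simp add: complex_eq_iff)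
  from arg_cong[OF this, of cnj] have w': "cnj w * of_real (cos \<theta>) = of_real (Re w) * cis (- \<theta>)"
    by (simp add: cis_cnj)
  have "w / cnj w = (w * of_real (cos \<theta>)) / (cnj w * of_real (cos \<theta>))" using c by simp
  also have "\<dots> = cis \<theta> / cis (- \<theta>)" unfolding w w' using assms by simp
  also have "\<dots> = cis (2 * \<theta>)" by (simp add: cis_divide)
  also have "\<dots> = exp (2 * \<i> * of_real \<theta>)" by (simp add: cis_conv_exp algebra_simps)
  finally show ?thesis by (simp add: \<theta>_def)
qed

lemma continuous_integer_valued_constant:
  fixes f :: "'a::topological_space \<Rightarrow> complex"
  assumes "connected S" "continuous_on S f" "\<And>x. x \<in> S \<Longrightarrow> f x \<in> \<int>"
  shows "\<exists>m::int. \<forall>x\<in>S. f x = of_int m"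
proof (cases "S = {}")
  case False
  have "f constant_on S"
  proof (rule continuous_discrete_range_constant[OF assms(1,2)])
    fix x assume "x \<in> S"
    have "1 \<le> norm (f y - f x)" if "y \<in> S" "f y \<noteq> f x" for y
    proof -
      obtain m where m: "f y - f x = of_int m"
        using assms(3)[OF \<open>y \<in> S\<close>] assms(3)[OF \<open>x \<in> S\<close>] by (metis Ints_cases Ints_diff)
      then have "m \<noteq> 0" using that by auto
      then show ?thesis unfolding m by simp
    qed
    then show "\<exists>e>0. \<forall>y. y \<in> S \<and> f y \<noteq> f x \<longrightarrow> e \<le> norm (f y - f x)"
      by (intro exI[of _ 1]) auto
  qed
  then show ?thesis using False assms(3) unfolding constant_on_def by (metis Ints_cases equals0I)
qed simp

text \<open>After multiplication by 2i both angles exponentiate to \<open>w t / cnj (w t)\<close>,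
  so they differ by an integer multiple of \<pi>. Both are continuous because the real part of
  \<open>w t\<close> does not vanish, and connectedness of \<open>C\<close> makes the integer
  constant.\<close>

lemma arctan_eq_log_ratio:
  assumes "connected C" "\<And>t. t \<in> C \<Longrightarrow> Im t > 0" "a \<noteq> 0"
    and g: "\<And>t. t \<in> C \<Longrightarrow> Re (of_real a * (t - of_real \<alpha>) * (cnj t - of_real \<beta>)) \<noteq> 0"
  obtains m :: int where "\<And>t. t \<in> C \<Longrightarrow>
    of_real (arctan (a * (\<alpha> - \<beta>) * Im t / Re (of_real a * (t - of_real \<alpha>) * (cnj t - of_real \<beta>))))
    = (log_ratio \<alpha> \<beta> t - log_ratio \<alpha> \<beta> (cnj t)) / (2 * \<i>) + of_int m * of_real pi"
proof -
  define w where "w = (\<lambda>t. of_real a * (t - of_real \<alpha>) * (cnj t - of_real \<beta>))"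
  define \<theta> where "\<theta> = (\<lambda>t. arctan (Im (w t) / Re (w t)))"
  have Im_w: "Im (w t) = a * (\<alpha> - \<beta>) * Im t" for t
    by (simp add: w_def algebra_simps)
  let ?l = "log_ratio \<alpha> \<beta>"
  let ?m = "\<lambda>t. (of_real (\<theta> t) - (?l t - ?l (cnj t)) / (2 * \<i>)) / of_real pi"
  have "\<exists>m::int. \<forall>t\<in>C. ?m t = of_int m"
  proof (rule continuous_integer_valued_constant[OF assms(1)])
    have nr: "t - of_real x \<notin> \<real>\<^sub>\<le>\<^sub>0" "cnj t - of_real x \<notin> \<real>\<^sub>\<le>\<^sub>0" if "t \<in> C" for t x
      using nonreal_diff(2)[of t] nonreal_diff(2)[of "cnj t"] assms(2)[OF that] by auto
    show "continuous_on C ?m"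
      unfolding \<theta>_def log_ratio_def w_def
      by (intro continuous_intros) (use nr g pi_neq_zero in auto)
    fix t assume t: "t \<in> C"
    then have y: "Im t \<noteq> 0" "Im (cnj t) \<noteq> 0" using assms(2) by fastforce+
    have "exp (2 * \<i> * of_real (\<theta> t)) = w t / cnj (w t)"
      unfolding \<theta>_def by (rule exp_2i_arctan) (use g[OF t] in \<open>simp add: w_def\<close>)
    also have "\<dots> = exp (?l t - ?l (cnj t))"
      using assms(3) by (simp add: exp_diff exp_log_ratio y w_def mult.commute)
    finally obtain n :: int where n: "2 * \<i> * of_real (\<theta> t) = ?l t - ?l (cnj t) + of_int (2 * n) * pi * \<i>"
      unfolding exp_eq by blast
    have "?l t - ?l (cnj t) = (2 * \<i>) * (of_real (\<theta> t) - of_int n * of_real pi)"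
      using n by (simp add: algebra_simps)
    then have "of_real (\<theta> t) = (?l t - ?l (cnj t)) / (2 * \<i>) + of_int n * of_real pi" by simp
    then have "?m t = of_int n" by simp
    then show "?m t \<in> \<int>" by simp
  qed
  then obtain m :: int where "\<And>t. t \<in> C \<Longrightarrow> ?m t = of_int m" by blast
  then have "of_real (\<theta> t) = (?l t - ?l (cnj t)) / (2 * \<i>) + of_int m * of_real pi" if "t \<in> C" for t
  proof -
    have "A = B + M * of_real pi" if "(A - B) / of_real pi = M" for A B M :: complex
      using that by (simp add: divide_eq_eq diff_eq_eq add.commute)
    then show ?thesis using \<open>t \<in> C\<close> \<open>\<And>t. t \<in> C \<Longrightarrow> ?m t = of_int m\<close> by blast
  qed
  then show thesis
    by (intro that[of m]) (simp only: \<theta>_def Im_w, simp only: w_def)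
qed

subsection \<open>A single term of the series\<close>

text \<open>Giving \<alpha> the root \<open>+ sqrt D\<close> makes
  \<open>a * (\<alpha> - \<beta>) = sqrt D\<close> for either sign of \<open>a\<close>, so the
  constants in the primitives are the same for all forms.\<close>

lemma form_roots:
  assumes "(a, b, c) \<in> forms D" "D > 0" "a \<noteq> 0"
  defines "\<alpha> \<equiv> (- real_of_int b + sqrt D) / (2 * real_of_int a)"
    and "\<beta> \<equiv> (- real_of_int b - sqrt D) / (2 * real_of_int a)"
  shows "form_at (a, b, c) z = of_real a * (z - of_real \<alpha>) * (z - of_real \<beta>)"
    and "a * (\<alpha> - \<beta>) = sqrt D"
    and "geodesic_fun (a, b, c) z = Re (of_real a * (z - of_real \<alpha>) * (cnj z - of_real \<beta>))"
proof -
  have D: "real_of_int D = (real_of_int b)\<^sup>2 - 4 * a * c"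
    using assms(1) by (auto simp: forms_def simp flip: of_int_power of_int_mult of_int_diff)
  have a: "real_of_int a \<noteq> 0" using assms(3) by simp
  have sum: "a * \<alpha> + a * \<beta> = - b" 
    using a by (simp add: \<alpha>_def \<beta>_def field_simps)
  have prod: "a * \<alpha> * \<beta> = c"
  proof -
    have "(- b + sqrt D) * (- b - sqrt D) = (real_of_int b)\<^sup>2 - (sqrt D)\<^sup>2"
      by (simp add: algebra_simps power2_eq_square)
    also have "\<dots> = 4 * a * c" using assms(2) D by simp
    finally have *: "(- b + sqrt D) * (- b - sqrt D) = 4 * a * c" .
    have "a * \<alpha> * \<beta> = ((- b + sqrt D) * (- b - sqrt D)) / (4 * a)"
      using a by (simp add: \<alpha>_def \<beta>_def)
    then show ?thesis unfolding * using a by simp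
  qed
  have "of_real a * (z - of_real \<alpha>) * (z - of_real \<beta>)
      = of_real a * z\<^sup>2 - of_real (a * \<alpha> + a * \<beta>) * z + of_real (a * \<alpha> * \<beta>)"
    by (simp add: algebra_simps power2_eq_square)
  then show "form_at (a, b, c) z = of_real a * (z - of_real \<alpha>) * (z - of_real \<beta>)"
    unfolding sum prod by (simp add: form_at_def)
  show "a * (\<alpha> - \<beta>) = sqrt D"
    using a by (simp add: \<alpha>_def \<beta>_def field_simps)
  have "Re (of_real a * (z - of_real \<alpha>) * (cnj z - of_real \<beta>))
      = a * ((Re z)\<^sup>2 + (Im z)\<^sup>2) - (a * \<alpha> + a * \<beta>) * Re z + a * \<alpha> * \<beta>"
    by (simp add: algebra_simps power2_eq_square)
  then show "geodesic_fun (a, b, c) z = Re (of_real a * (z - of_real \<alpha>) * (cnj z - of_real \<beta>))"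
    unfolding sum prod by (simp add: geodesic_fun_def cmod_power2)
qed

text \<open>With \<open>T = sqrt D * Im t / \<bar>g\<bar>\<close>, the squared sine of
  \<open>arctan T\<close> is the argument of \<open>psi\<close> by \<open>norm_form_at\<close>.
  Oddness of the primitive then replaces \<open>\<bar>g\<bar>\<close> by \<open>g\<close>.\<close>

lemma sgn_psi_eq:
  assumes "D > 0" "Q \<in> forms D" "k \<ge> 2" "geodesic_fun Q t \<noteq> 0" "Im t > 0"
  shows "of_real (sgn (geodesic_fun Q t)) *
      of_real (psi k (real_of_int D * (Im t)\<^sup>2 / (cmod (form_at Q t))\<^sup>2)) =
      sin_prim (k - 1) (of_real (arctan (sqrt D * Im t / geodesic_fun Q t))) - sin_prim (k - 1) 0"
    and "norm (sin_prim (k - 1) (of_real (arctan (sqrt D * Im t / geodesic_fun Q t))) - sin_prim (k - 1) 0)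
      \<le> 3 * (sqrt D * Im t / cmod (form_at Q t)) ^ (2 * (k - 1) + 1)"
proof -
  let ?g = "geodesic_fun Q t"
  define T where "T = sqrt D * Im t / \<bar>?g\<bar>"
  define \<theta> where "\<theta> = arctan T"
  have T0: "T > 0" using assms by (simp add: T_def)
  have \<theta>: "0 \<le> \<theta>" "\<theta> < pi / 2" using T0 arctan_ubound by (auto simp: \<theta>_def)
  have nrm: "(cmod (form_at Q t))\<^sup>2 = ?g\<^sup>2 * (1 + T\<^sup>2)"
    using norm_form_at[OF assms(2), of t] assms(1,4)
    by (simp add: T_def power_divide power_mult_distrib field_simps)
  have sin2: "(sin \<theta>)\<^sup>2 = real_of_int D * (Im t)\<^sup>2 / (cmod (form_at Q t))\<^sup>2"
  proof -
    have "(sin \<theta>)\<^sup>2 = T\<^sup>2 / (1 + T\<^sup>2)"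
      by (simp add: \<theta>_def sin_arctan power_divide)
    also have "\<dots> = (?g\<^sup>2 * T\<^sup>2) / (?g\<^sup>2 * (1 + T\<^sup>2))"
      using assms(4) by simp
    also have "?g\<^sup>2 * T\<^sup>2 = D * (Im t)\<^sup>2"
      using assms(1,4) by (simp add: T_def power_divide power_mult_distrib)
    finally show ?thesis by (simp only: nrm)
  qed
  have "sin \<theta> \<ge> 0" using \<theta> by (intro sin_ge_zero) auto
  moreover have "(sqrt D * Im t / cmod (form_at Q t))\<^sup>2 = real_of_int D * (Im t)\<^sup>2 / (cmod (form_at Q t))\<^sup>2"
    using assms(1) by (simp only: power_divide power_mult_distrib) simp
  moreover have "sqrt D * Im t / cmod (form_at Q t) \<ge> 0" using assms(1,5) by simp
  ultimately have sin: "sin \<theta> = sqrt D * Im t / cmod (form_at Q t)"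
    using sin2 power2_eq_imp_eq by metis
  have psi: "of_real (psi k (real_of_int D * (Im t)\<^sup>2 / (cmod (form_at Q t))\<^sup>2))
      = sin_prim (k - 1) (of_real \<theta>) - sin_prim (k - 1) 0"
    using psi_sin[OF assms(3) \<theta>] by (simp add: sin2)
  have *: "of_real (sgn ?g) * (sin_prim (k - 1) (of_real \<theta>) - sin_prim (k - 1) 0)
      = sin_prim (k - 1) (of_real (arctan (sqrt D * Im t / ?g))) - sin_prim (k - 1) 0"
  proof (cases "?g > 0")
    case True
    then show ?thesis by (simp add: \<theta>_def T_def)
  next
    case False
    then have g: "?g < 0" using assms(4) by simp
    then have "arctan (sqrt D * Im t / ?g) = - \<theta>" by (simp add: \<theta>_def T_def flip: arctan_minus)
    then show ?thesis using g sin_prim_odd[of "k - 1" "of_real \<theta>"] by simp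
  qed
  then show "of_real (sgn ?g) * of_real (psi k (real_of_int D * (Im t)\<^sup>2 / (cmod (form_at Q t))\<^sup>2))
      = sin_prim (k - 1) (of_real (arctan (sqrt D * Im t / ?g))) - sin_prim (k - 1) 0"
    by (simp only: psi)
  show "norm (sin_prim (k - 1) (of_real (arctan (sqrt D * Im t / ?g))) - sin_prim (k - 1) 0)
      \<le> 3 * (sqrt D * Im t / cmod (form_at Q t)) ^ (2 * (k - 1) + 1)"
    using norm_sin_prim_le[OF \<theta>, of "k - 1"] assms(4)
    unfolding *[symmetric] sin norm_mult by (simp add: sgn_if)
qed

lemma has_contour_integral_primitive_upper:
  assumes "\<And>z. Im z > 0 \<Longrightarrow> (F has_field_derivative f z) (at z)" "Im u > 0" "Im v > 0"
  shows "(f has_contour_integral F v - F u) (linepath u v)"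
proof -
  have "convex {z. Im z > 0}" by (simp add: convex_halfspace_Im_gt)
  then have "closed_segment u v \<subseteq> {z. Im z > 0}"
    using assms(2,3) by (intro closed_segment_subset) auto
  then show ?thesis
    using contour_integral_primitive[of "{z. Im z > 0}" F f "linepath u v"] assms(1)
    by (auto intro: DERIV_subset)
qed

definition F_term :: "nat \<Rightarrow> int \<Rightarrow> complex \<Rightarrow> int \<times> int \<times> int \<Rightarrow> complex" where
  "F_term k D t Q = of_real (sgn (geodesic_fun Q t)) * form_at Q t ^ (k - 1) *
     of_real (psi k (real_of_int D * (Im t)\<^sup>2 / (cmod (form_at Q t))\<^sup>2))"

text \<open>The sine power of order 2k - 1 against the factor \<open>Q(t)^(k-1)\<close> leaves
  \<open>\<bar>Q(t)\<bar>^(-k)\<close>, which is summable.\<close>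

lemma F_term_summable:
  assumes sq: "\<nexists>m::int. D = m\<^sup>2" and D: "D > 0" and k: "k \<ge> 2" and t: "Im t > 0"
    and g: "\<And>Q. Q \<in> forms D \<Longrightarrow> geodesic_fun Q t \<noteq> 0"
  shows "F_term k D t summable_on forms D"
proof (rule abs_summable_summable, rule summable_on_comparison_test)
  let ?c = "3 * (sqrt D * Im t) ^ (2 * (k - 1) + 1)"
  show "(\<lambda>Q. ?c * norm (1 / form_at Q t ^ k)) summable_on forms D"
    by (intro summable_on_cmult_right form_sum_abs_summable sq D k t)
  show "norm (F_term k D t Q) \<le> ?c * norm (1 / form_at Q t ^ k)" if Q: "Q \<in> forms D" for Q
  proof -
    let ?q = "cmod (form_at Q t)"
    have q: "?q > 0" using form_at_nonzero[OF sq D Q] t by simp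
    let ?s = "sin_prim (k - 1) (of_real (arctan (sqrt D * Im t / geodesic_fun Q t))) - sin_prim (k - 1) 0"
    have "F_term k D t Q = form_at Q t ^ (k - 1) * ?s"
      unfolding sgn_psi_eq(1)[OF D Q k g[OF Q] t, symmetric] by (simp add: F_term_def)
    then have "norm (F_term k D t Q) = ?q ^ (k - 1) * norm ?s"
      by (simp only: norm_mult norm_power)
    also have "\<dots> \<le> ?q ^ (k - 1) * (3 * (sqrt D * Im t / ?q) ^ (2 * (k - 1) + 1))"
      by (rule mult_left_mono[OF sgn_psi_eq(2)[OF D Q k g[OF Q] t]]) simp
    also have "\<dots> = ?c * (?q ^ (k - 1) / ?q ^ (2 * (k - 1) + 1))"
      by (simp add: power_divide)
    also have "?q ^ (k - 1) / ?q ^ (2 * (k - 1) + 1) = 1 / ?q ^ k"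
    proof -
      have "2 * (k - 1) + 1 = (k - 1) + k" using k by simp
      then show ?thesis using q by (simp only: power_add) simp
    qed
    finally show ?thesis by (simp add: norm_divide norm_power)
  qed
qed simp

text \<open>Up to a multiple of \<open>Q(t)^(k-1)\<close>, the term is \<open>form_prim\<close> at
  \<open>z = cnj t\<close> minus its value at \<open>z = t\<close>. The way between these arguments
  passes through \<open>cnj t0\<close> and \<open>t0\<close>: inside each half-plane the change is
  an integral, and the jump between the half-planes is a polynomial.\<close>

lemma F_term_eq:
  assumes sq: "\<nexists>m::int. D = m\<^sup>2" and D: "D > 0" and k: "k \<ge> 2" and Q: "Q \<in> forms D"
    and C: "connected C" "\<And>t. t \<in> C \<Longrightarrow> Im t > 0" and t0: "Im t0 > 0"
    and g: "\<And>t. t \<in> C \<Longrightarrow> geodesic_fun Q t \<noteq> 0"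
  defines "\<kappa> \<equiv> (- of_int D / 4) ^ (k - 1) * (\<i> / 2 * of_real (sqrt D))"
  shows "\<exists>p. degree p \<le> 2 * (k - 1) \<and> (\<forall>t\<in>C. F_term k D t Q = poly p t
     - \<kappa> * contour_integral (linepath (- cnj t0) (- cnj t)) (\<lambda>z. (z + t) ^ (2 * (k - 1)) * (1 / form_at Q (- z) ^ k))
     - \<kappa> * contour_integral (linepath t0 t) (\<lambda>z. (z - t) ^ (2 * (k - 1)) * (1 / form_at Q z ^ k)))"
proof -
  obtain a b c where abc: "Q = (a, b, c)" by (cases Q)
  define n where "n = k - 1"
  have k_eq: "k = Suc n" using k by (simp add: n_def)
  have a: "a \<noteq> 0" using form_coeff_nonzero[OF sq] Q abc by blast
  define \<alpha> where "\<alpha> = (- real_of_int b + sqrt D) / (2 * real_of_int a)"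
  define \<beta> where "\<beta> = (- real_of_int b - sqrt D) / (2 * real_of_int a)"
  note roots = form_roots[OF Q[unfolded abc] D a, folded \<alpha>_def \<beta>_def abc]
  define q :: "complex poly" where "q = smult (of_int a) ([:- of_real \<alpha>, 1:] * [:- of_real \<beta>, 1:])"
  have q: "poly q t = form_at Q t" for t
    unfolding roots(1) q_def by (simp add: algebra_simps)
  let ?FP = "form_prim n a \<alpha> \<beta>"
  have \<kappa>0: "\<kappa> \<noteq> 0" using D by (simp add: \<kappa>_def)
  have deriv: "((\<lambda>z. ?FP t z / \<kappa>) has_field_derivative (z - t) ^ (2 * n) * (1 / form_at Q z ^ k)) (at z)"
    if "Im t \<noteq> 0" "Im z \<noteq> 0" for t z
  proof -
    have "(complex_of_real (sqrt D))\<^sup>2 = of_int D" using D by (simp flip: of_real_power)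
    moreover have "(t - z) ^ (2 * n) = (z - t) ^ (2 * n)" by (simp add: power_mult power2_commute)
    ultimately have "(?FP t has_field_derivative \<kappa> * ((z - t) ^ (2 * n) * (1 / form_at Q z ^ k))) (at z)"
      using has_field_derivative_form_prim[of "real_of_int a" t z n \<alpha> \<beta>] a that
      by (simp add: roots(2) roots(1) \<kappa>_def k_eq del: power_Suc)
    from DERIV_cdivide[OF this, of \<kappa>] show ?thesis using \<kappa>0 by simp
  qed
  have int2: "\<kappa> * contour_integral (linepath t0 t) (\<lambda>z. (z - t) ^ (2 * n) * (1 / form_at Q z ^ k))
      = ?FP t t - ?FP t t0" if t: "Im t > 0" for t
  proof -
    have "contour_integral (linepath t0 t) (\<lambda>z. (z - t) ^ (2 * n) * (1 / form_at Q z ^ k))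
        = ?FP t t / \<kappa> - ?FP t t0 / \<kappa>"
      by (rule contour_integral_unique, rule has_contour_integral_primitive_upper)
         (use deriv t t0 in auto)
    then show ?thesis using \<kappa>0 by (simp add: diff_divide_distrib[symmetric])
  qed
  \<comment> \<open>The lower half-plane path is carried to the upper one by z to -z, which explains
    \<open>- cnj t\<close> and \<open>form_at Q (- z)\<close>.\<close>
  have int1: "\<kappa> * contour_integral (linepath (- cnj t0) (- cnj t)) (\<lambda>z. (z + t) ^ (2 * n) * (1 / form_at Q (- z) ^ k))
      = ?FP t (cnj t0) - ?FP t (cnj t)" if t: "Im t > 0" for t
  proof -
    have "contour_integral (linepath (- cnj t0) (- cnj t)) (\<lambda>z. (z + t) ^ (2 * n) * (1 / form_at Q (- z) ^ k))
        = - (?FP t (- (- cnj t)) / \<kappa>) - - (?FP t (- (- cnj t0)) / \<kappa>)"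
    proof (rule contour_integral_unique, rule has_contour_integral_primitive_upper)
      fix z :: complex assume z: "Im z > 0"
      have "((\<lambda>z. - (?FP t (- z) / \<kappa>)) has_field_derivative
          - ((- z - t) ^ (2 * n) * (1 / form_at Q (- z) ^ k) * - 1)) (at z)"
        by (intro DERIV_minus DERIV_chain2[OF deriv]) (use t z in \<open>auto intro!: derivative_eq_intros\<close>)
      moreover have "(- z - t) ^ (2 * n) = (z + t) ^ (2 * n)"
      proof -
        have "(- z - t)\<^sup>2 = (z + t)\<^sup>2" by (simp add: power2_eq_square algebra_simps)
        then show ?thesis by (simp add: power_mult)
      qed
      ultimately show "((\<lambda>z. - (?FP t (- z) / \<kappa>)) has_field_derivative
          (z + t) ^ (2 * n) * (1 / form_at Q (- z) ^ k)) (at z)" by simp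
    qed (use t t0 in auto)
    then have eq: "contour_integral (linepath (- cnj t0) (- cnj t)) (\<lambda>z. (z + t) ^ (2 * n) * (1 / form_at Q (- z) ^ k))
        = (?FP t (cnj t0) - ?FP t (cnj t)) / \<kappa>"
      by (simp add: diff_divide_distrib)
    show ?thesis unfolding eq using \<kappa>0 by simp
  qed
  obtain m :: int where m: "\<And>t. t \<in> C \<Longrightarrow>
    of_real (arctan (sqrt D * Im t / geodesic_fun Q t))
    = (log_ratio \<alpha> \<beta> t - log_ratio \<alpha> \<beta> (cnj t)) / (2 * \<i>) + of_int m * of_real pi"
    using arctan_eq_log_ratio[OF C, of "real_of_int a" \<alpha> \<beta>] a g roots(2,3) by auto
  \<comment> \<open>The shift from \<open>sin_prim_shift\<close>; as \<open>m\<close> does not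
    depend on \<open>t\<close>, it contributes a constant multiple of
    \<open>form_at Q t ^ n\<close>.\<close>
  define c0 :: complex where "c0 = (- 1 / 4) ^ n * ((- 1) ^ n * of_nat (2 * n choose n) * (of_int m * of_real pi))"
  obtain p where p: "degree p \<le> 2 * n" "\<And>t. Im t \<noteq> 0 \<Longrightarrow> poly p t = ?FP t (cnj t0) - ?FP t t0"
    using form_prim_diff_poly[of n "real_of_int a" \<alpha> \<beta> "cnj t0" t0] by blast
  have "degree (p + smult c0 (q ^ n)) \<le> 2 * n"
  proof -
    have "degree q \<le> 2" by (simp add: q_def)
    then have "degree (q ^ n) \<le> 2 * n"
      using degree_power_le[of q n] by (meson le_trans mult_le_mono1)
    then show ?thesis using p(1) degree_smult_le[of c0 "q ^ n"] by (intro degree_add_le) auto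
  qed
  moreover have "F_term k D t Q = poly (p + smult c0 (q ^ n)) t
     - \<kappa> * contour_integral (linepath (- cnj t0) (- cnj t)) (\<lambda>z. (z + t) ^ (2 * n) * (1 / form_at Q (- z) ^ k))
     - \<kappa> * contour_integral (linepath t0 t) (\<lambda>z. (z - t) ^ (2 * n) * (1 / form_at Q z ^ k))" if t: "t \<in> C" for t
  proof -
    have y: "Im t > 0" using C(2) t .
    have "F_term k D t Q = form_at Q t ^ n * (of_real (sgn (geodesic_fun Q t)) *
        of_real (psi k (real_of_int D * (Im t)\<^sup>2 / (cmod (form_at Q t))\<^sup>2)))"
      by (simp add: F_term_def n_def)
    also have "\<dots> = form_at Q t ^ n * (sin_prim n ((log_ratio \<alpha> \<beta> t - log_ratio \<alpha> \<beta> (cnj t)) / (2 * \<i>)) + c0 - sin_prim n 0)"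
      unfolding sgn_psi_eq(1)[OF D Q k g[OF t] y] m[OF t] sin_prim_shift c0_def n_def ..
    also have "\<dots> = ?FP t (cnj t) + c0 * form_at Q t ^ n - ?FP t t"
    proof -
      have "X * (u + c - v) = X * u + c * X - X * v" for X u c v :: complex
        by (simp add: algebra_simps)
      then show ?thesis
        unfolding form_prim_diagonal unfolding form_prim_def roots(1)[symmetric] .
    qed
    finally show ?thesis
      unfolding int1[OF y] int2[OF y] using y by (simp add: p(2) q)
  qed
  ultimately show ?thesis unfolding n_def by blast
qed

subsection \<open>Summation over all forms\<close>

text \<open>The basis \<open>l\<close> depends on the nodes alone, so the same one serves infinitely
  many polynomials at once.\<close>

lemma lagrange_interpolation:
  fixes X :: "'a::field set"
  assumes "finite X"
  obtains l where "\<And>x. x \<in> X \<Longrightarrow> degree (l x) < card X"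
    "\<And>p t. degree p < card X \<Longrightarrow> poly p t = (\<Sum>x\<in>X. poly p x * poly (l x) t)"
proof
  define l where "l = (\<lambda>x. \<Prod>y\<in>X - {x}. smult (1 / (x - y)) [:- y, 1:])"
  show deg: "degree (l x) < card X" if "x \<in> X" for x
  proof -
    have "degree (l x) \<le> (\<Sum>y\<in>X - {x}. degree (smult (1 / (x - y)) [:- y, 1:]))"
      unfolding l_def by (rule degree_prod_sum_le[unfolded o_def]) (use assms in auto)
    also have "\<dots> \<le> (\<Sum>y\<in>X - {x}. 1)"
      by (intro sum_mono) (auto intro: order_trans[OF degree_smult_le])
    also have "\<dots> < card X" using card_Diff1_less[OF assms that] by simp
    finally show ?thesis .
  qed
  fix p :: "'a poly" and t assume p: "degree p < card X"
  define r where "r = (\<Sum>x\<in>X. smult (poly p x) (l x))"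
  have l_eq: "poly (l x) z = (if z = x then 1 else 0)" if "x \<in> X" "z \<in> X" for x z
  proof (cases "z = x")
    case True
    have "poly (l x) x = 1" unfolding l_def poly_prod
      by (intro prod.neutral) (auto simp flip: diff_divide_distrib)
    then show ?thesis using True by simp
  next
    case False
    have "poly (smult (1 / (x - z)) [:- z, 1:]) z = 0" by simp
    then have "poly (l x) z = 0"
      unfolding l_def poly_prod using False that assms
      by (intro prod_zero) (auto intro!: bexI[of _ z])
    then show ?thesis using False by simp
  qed
  have "poly r z = poly p z" if "z \<in> X" for z
  proof -
    have "poly r z = (\<Sum>x\<in>X. if z = x then poly p x else 0)"
      unfolding r_def poly_sum using l_eq[OF _ that] by (intro sum.cong) auto
    then show ?thesis using assms that by simp
  qed
  moreover have "degree r < card X"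
  proof -
    have "degree (smult (poly p x) (l x)) \<le> card X - 1" if "x \<in> X" for x
      using deg[OF that] degree_smult_le[of "poly p x" "l x"] by linarith
    then have "degree r \<le> card X - 1" unfolding r_def by (intro degree_sum_le assms)
    then show ?thesis using p by linarith
  qed
  ultimately have "r = p"
    using p by (intro poly_eqI_degree[of X]) auto
  then show "poly p t = (\<Sum>x\<in>X. poly p x * poly (l x) t)"
    unfolding r_def by (metis (no_types, lifting) poly_smult poly_sum sum.cong)
qed

text \<open>Each value \<open>poly (p x) t\<close> is one fixed linear combination of the values at
  N + 1 nodes of \<open>C\<close>. Summation over \<open>x\<close> commutes with this finite
  combination, so no separate control of the coefficients is required.\<close>

lemma has_sum_poly:
  fixes p :: "'a \<Rightarrow> complex poly"
  assumes "infinite C" "\<And>x. x \<in> A \<Longrightarrow> degree (p x) \<le> N"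
    and S: "\<And>t. t \<in> C \<Longrightarrow> ((\<lambda>x. poly (p x) t) has_sum S t) A"
  shows "\<exists>P. degree P \<le> N \<and> (\<forall>t\<in>C. S t = poly P t)"
proof -
  obtain X where X: "X \<subseteq> C" "finite X" "card X = Suc N"
    using infinite_arbitrarily_large[OF assms(1)] by blast
  obtain l where l: "\<And>x. x \<in> X \<Longrightarrow> degree (l x) < card X"
    "\<And>p t. degree p < card X \<Longrightarrow> poly p t = (\<Sum>x\<in>X. poly p x * poly (l x) t :: complex)"
    using lagrange_interpolation[OF X(2)] by blast
  define P where "P = (\<Sum>x\<in>X. smult (S x) (l x))"
  have "degree (smult (S x) (l x)) \<le> N" if "x \<in> X" for x
    using l(1)[OF that] degree_smult_le[of "S x" "l x"] X(3) by linarith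
  then have "degree P \<le> N" unfolding P_def by (intro degree_sum_le X)
  moreover have "S t = poly P t" if "t \<in> C" for t
  proof -
    have "((\<lambda>y. \<Sum>x\<in>Y. poly (p y) x * poly (l x) t) has_sum (\<Sum>x\<in>Y. S x * poly (l x) t)) A"
      if "finite Y" "Y \<subseteq> X" for Y
      using that X(1) by (induction Y rule: finite_induct) (auto intro!: has_sum_add has_sum_cmult_left S)
    from this[OF X(2) order_refl]
    have "((\<lambda>y. poly (p y) t) has_sum (\<Sum>x\<in>X. S x * poly (l x) t)) A"
      by (rule has_sum_cong[THEN iffD1, rotated]) (use assms(2) X(3) in \<open>auto simp: l(2) less_Suc_eq_le\<close>)
    from has_sum_unique[OF S[OF \<open>t \<in> C\<close>] this] show ?thesis
      by (simp add: P_def poly_sum)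
  qed
  ultimately show ?thesis by blast
qed

lemma contour_integral_form_sum:
  assumes sq: "\<nexists>m::int. D = m\<^sup>2" and D: "D > 0" and k: "k \<ge> 2" and u: "Im u > 0" and v: "Im v > 0"
    and h: "continuous_on UNIV h"
  shows "((\<lambda>Q. contour_integral (linepath u v) (\<lambda>z. h z * (1 / form_at Q z ^ k))) has_sum
    contour_integral (linepath u v) (\<lambda>z. h z * form_sum k D z)) (forms D)"
proof -
  let ?K = "closed_segment u v"
  have "convex {z. Im z > 0}" by (simp add: convex_halfspace_Im_gt)
  then have K: "?K \<subseteq> {z. Im z > 0}" using u v by (intro closed_segment_subset) auto
  have cont: "continuous_on ?K (\<lambda>z. h z * (1 / form_at Q z ^ k))" if Q: "Q \<in> forms D" for Q
  proof (intro continuous_intros)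
    show "continuous_on ?K h" using h continuous_on_subset by blast
    show "continuous_on ?K (form_at Q)"
      unfolding form_at_def case_prod_unfold by (intro continuous_intros)
    show "\<forall>z\<in>?K. form_at Q z ^ k \<noteq> 0"
      using form_at_nonzero[OF sq D Q] K by fastforce
  qed
  have int: "(\<lambda>z. h z * (1 / form_at Q z ^ k)) contour_integrable_on linepath u v" if "Q \<in> forms D" for Q
    by (rule contour_integrable_continuous_linepath[OF cont[OF that]])
  have lim: "uniform_limit ?K (\<lambda>X z. \<Sum>Q\<in>X. 1 / form_at Q z ^ k) (form_sum k D) (finite_subsets_at_top (forms D))"
    using K by (intro form_sum_uniform_limit sq D k) auto
  have cont_sum: "continuous_on ?K (form_sum k D)"
    using holomorphic_on_imp_continuous_on[OF form_sum_holomorphic[OF sq D k]] K continuous_on_subset by blast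
  have "uniform_limit ?K (\<lambda>X z. h z * (\<Sum>Q\<in>X. 1 / form_at Q z ^ k)) (\<lambda>z. h z * form_sum k D z)
      (finite_subsets_at_top (forms D))"
  proof (rule uniform_lim_mult[OF uniform_limit_const lim])
    show "bounded (h ` ?K)" "bounded (form_sum k D ` ?K)"
      using h cont_sum
      by (auto intro!: compact_imp_bounded compact_continuous_image intro: continuous_on_subset)
  qed
  then have ul: "uniform_limit (path_image (linepath u v)) (\<lambda>X z. \<Sum>Q\<in>X. h z * (1 / form_at Q z ^ k))
      (\<lambda>z. h z * form_sum k D z) (finite_subsets_at_top (forms D))"
    by (simp only: path_image_linepath sum_distrib_left)
  have ev: "\<forall>\<^sub>F X in finite_subsets_at_top (forms D).
      (\<lambda>z. \<Sum>Q\<in>X. h z * (1 / form_at Q z ^ k)) contour_integrable_on linepath u v"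
    using int by (intro eventually_finite_subsets_at_top_weakI contour_integrable_sum) auto
  have "((\<lambda>X. contour_integral (linepath u v) (\<lambda>z. \<Sum>Q\<in>X. h z * (1 / form_at Q z ^ k)))
      \<longlongrightarrow> contour_integral (linepath u v) (\<lambda>z. h z * form_sum k D z)) (finite_subsets_at_top (forms D))"
    by (rule contour_integral_uniform_limit(2)[OF ev ul, where B = "norm (v - u)"]) auto
  moreover have "\<forall>\<^sub>F X in finite_subsets_at_top (forms D).
      contour_integral (linepath u v) (\<lambda>z. \<Sum>Q\<in>X. h z * (1 / form_at Q z ^ k))
      = (\<Sum>Q\<in>X. contour_integral (linepath u v) (\<lambda>z. h z * (1 / form_at Q z ^ k)))"
    using int by (intro eventually_finite_subsets_at_top_weakI contour_integral_sum) auto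
  ultimately show ?thesis
    unfolding has_sum_def by (rule Lim_transform_eventually)
qed

lemma contour_integral_form_sum_reflect:
  assumes "\<nexists>m::int. D = m\<^sup>2" "D > 0" "k \<ge> 2" "Im u > 0" "Im v > 0" "continuous_on UNIV h"
  shows "((\<lambda>Q. contour_integral (linepath u v) (\<lambda>z. h z * (1 / form_at Q (- z) ^ k))) has_sum
    contour_integral (linepath u v) (\<lambda>z. h z * form_sum k D z)) (forms D)"
proof -
  have bij: "bij_betw (\<lambda>(a, b, c). (a, - b, c)) (forms D) (forms D)"
    by (rule bij_betwI[where g = "\<lambda>(a, b, c). (a, - b, c)"]) (auto simp: forms_def)
  have "form_at Q (- z) = form_at ((\<lambda>(a, b, c). (a, - b, c)) Q) z" for Q z
    by (cases Q) (simp add: form_at_def)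
  then show ?thesis
    using has_sum_reindex_bij_betw[OF bij, of "\<lambda>Q. contour_integral (linepath u v) (\<lambda>z. h z * (1 / form_at Q z ^ k))"]
      contour_integral_form_sum[OF assms] by simp
qed

section \<open>Fourier series of f and matching of constants\<close>

lemma f_form_eq:
  "f_form k D z = of_real (real_of_int D powr (real k - 1 / 2) / (real ((2 * k - 2) choose (k - 1)) * pi)) * form_sum k D z"
  by (simp add: f_form_def form_sum_def)

lemma f_form_fourier:
  assumes "\<nexists>m::int. D = m\<^sup>2" "D > 0" "k \<ge> 2"
  obtains a where "a 0 = 0" "\<And>z. Im z > 0 \<Longrightarrow> (\<lambda>n. a n * nome z ^ n) sums f_form k D z"
proof -
  let ?c = "of_real (real_of_int D powr (real k - 1 / 2) / (real ((2 * k - 2) choose (k - 1)) * pi)) :: complex"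
  obtain B where B: "\<And>z. \<bar>Re z\<bar> \<le> 1 \<Longrightarrow> Im z \<ge> 1 \<Longrightarrow> norm (form_sum k D z) \<le> B / Im z"
    using form_sum_decay[OF assms] by blast
  show thesis
  proof (rule fourier_expansion)
    show "f_form k D holomorphic_on {z. Im z > 0}"
      unfolding f_form_eq[abs_def] by (intro holomorphic_intros form_sum_holomorphic assms)
    show "f_form k D (z + 1) = f_form k D z" for z
      by (simp add: f_form_eq form_sum_periodic)
    show "norm (f_form k D z) \<le> norm ?c * B / Im z" if "\<bar>Re z\<bar> \<le> 1" "Im z \<ge> 1" for z
      unfolding f_form_eq norm_mult using mult_left_mono[OF B[OF that], of "norm ?c"] by simp
  qed (rule that)
qed

lemma power_int_minus_two_i: "k \<ge> 1 \<Longrightarrow> (- 2 * \<i>) powi (1 - 2 * int k) = (\<i> / 2) ^ (2 * k - 1)"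
proof -
  assume "k \<ge> 1"
  then have "1 - 2 * int k = - int (2 * k - 1)" by simp
  then have "(- 2 * \<i>) powi (1 - 2 * int k) = inverse (- 2 * \<i>) ^ (2 * k - 1)"
    by (simp only: power_int_minus power_int_of_nat power_inverse)
  also have "inverse (- 2 * \<i>) = \<i> / 2" by (simp add: complex_eq_iff)
  finally show ?thesis .
qed

text \<open>Because \<open>(\<i> / 2)\<^sup>2 = - 1 / 4\<close>, the constant of the single-form
  primitives is the power of D in \<open>f_form\<close> times the constant in front of
  \<open>nonhol_eichler\<close>.\<close>

lemma form_prim_constant_eq:
  assumes "D > 0" "k \<ge> 1"
  shows "(- of_int D / 4) ^ (k - 1) * (\<i> / 2 * of_real (sqrt D))
    = of_real (real_of_int D powr (real k - 1 / 2)) * (\<i> / 2) ^ (2 * k - 1)"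
proof -
  have D: "real_of_int D > 0" using assms by simp
  have "real k - 1 / 2 = real (k - 1) + 1 / 2" using assms(2) by (simp add: of_nat_diff)
  then have 1: "real_of_int D powr (real k - 1 / 2) = real_of_int D ^ (k - 1) * sqrt D"
    using D by (simp only: powr_add powr_realpow powr_half_sqrt)
  have "2 * k - 1 = 2 * (k - 1) + 1" using assms(2) by simp
  then have 2: "(\<i> / 2) ^ (2 * k - 1) = ((\<i> / 2)\<^sup>2) ^ (k - 1) * (\<i> / 2)"
    by (simp only: power_add power_mult power_one_right)
  have "(\<i> / 2)\<^sup>2 = - 1 / 4" by (simp add: power_divide)
  moreover have "(- of_int D / 4 :: complex) ^ (k - 1) = of_int D ^ (k - 1) * (- 1 / 4) ^ (k - 1)"
    by (simp flip: power_mult_distrib)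
  ultimately show ?thesis unfolding 1 2 by simp
qed

lemma sums_at_nome_imp_summable:
  assumes "\<And>z. Im z > 0 \<Longrightarrow> (\<lambda>n. a n * nome z ^ n) sums f z" "norm q < 1"
  shows "summable (\<lambda>n. a n * q ^ n)"
proof (cases "q = 0")
  case True
  then show ?thesis using sums_summable[OF powser_sums_zero[of a]] by simp
next
  case False
  then show ?thesis using sums_summable[OF assms(1)[OF nome_surj[OF False assms(2)]]] nome_Ln[OF False] by simp
qed

theorem theorem1p3:
  fixes k :: nat and D :: int and C :: "complex set"
  assumes "k > 1"
    and "D > 0" and "discriminant D" and "\<not> (\<exists>m::int. D = m\<^sup>2)"
    and "C \<in> components (upper_half_plane - exceptional_set D)"
  shows "\<exists>P :: complex poly. degree P \<le> 2 * k - 2 \<and>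
    (\<forall>\<tau> \<in> C. F_fun k D \<tau> =
       poly P \<tau>
       + of_real (real_of_int D powr (1 / 2 - real k)) * nonhol_eichler k (f_form k D) \<tau>
       - of_real (real_of_int D powr (1 / 2 - real k)) *
         of_real (fact (2 * k - 2) / (4 * pi) ^ (2 * k - 1)) * hol_eichler k (f_form k D) \<tau>)"
proof (cases "finite C")
  case True
    \<comment> \<open>Impossible, but excluding it would need that the exceptional set is relatively closed.\<close>
  then obtain \<tau> where "C = {\<tau>}"
    using in_components_connected[OF assms(5)] in_components_nonempty[OF assms(5)]
    by (metis connected_finite_iff_sing)
  then show ?thesis
    by (intro exI[of _ "[:F_fun k D \<tau>
       - of_real (real_of_int D powr (1 / 2 - real k)) * nonhol_eichler k (f_form k D) \<tau>
       + of_real (real_of_int D powr (1 / 2 - real k)) *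
         of_real (fact (2 * k - 2) / (4 * pi) ^ (2 * k - 1)) * hol_eichler k (f_form k D) \<tau>:]"]) simp
next
  case False
  note D = assms(2) and sq = assms(4)
  have k: "k \<ge> 2" using assms(1) by simp
  define m where "m = 2 * (k - 1)"
  have m: "2 * k - 2 = m" "2 * k - 1 = Suc m" using k by (simp_all add: m_def)
  define \<omega> where "\<omega> = (\<i> / 2) ^ Suc m"
  define \<kappa> where "\<kappa> = (- of_int D / 4) ^ (k - 1) * (\<i> / 2 * complex_of_real (sqrt D))"
  define N where "N = real (m choose (k - 1)) * pi"
  define K where "K = complex_of_real (real_of_int D powr (real k - 1 / 2) / N)"
  define d where "d = complex_of_real (real_of_int D powr (1 / 2 - real k))"
  have N0: "N \<noteq> 0" by (simp add: N_def m_def)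
  have K0: "K \<noteq> 0" using D N0 by (simp add: K_def)
  have \<kappa>: "\<kappa> = K * of_real N * \<omega>"
  proof -
    have "1 \<le> k" using k by simp
    then show ?thesis
      unfolding \<kappa>_def form_prim_constant_eq[OF D \<open>1 \<le> k\<close>] K_def \<omega>_def m(2) using N0 by simp
  qed
  have f: "f_form k D z = K * form_sum k D z" for z
    by (simp add: f_form_eq K_def N_def m(1))

  \<comment> \<open>Both Eichler integrals through iterated antiderivatives\<close>
  obtain a where a0: "a 0 = 0" and a: "\<And>z. Im z > 0 \<Longrightarrow> (\<lambda>n. a n * nome z ^ n) sums f_form k D z"
    using f_form_fourier[OF sq D k] by blast
  have coeff: "cusp_coeff (f_form k D) = a" using cusp_coeff_eqI[of a, OF a0 a] by blast
  note summable = sums_at_nome_imp_summable[OF a]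
  let ?A = "eichler a"
  have A0: "?A 0 z = f_form k D z" if "Im z > 0" for z
    using sums_unique[OF a[OF that]] by (simp add: eichler_def)
  have line: "contour_integral (linepath u v) (\<lambda>z. (z - t) ^ m * f_form k D z) = parts m ?A t v - parts m ?A t u"
    if "Im u > 0" "Im v > 0" for t u v
  proof (rule contour_integral_unique, rule has_contour_integral_primitive_upper[OF _ that])
    show "(parts m ?A t has_field_derivative (z - t) ^ m * f_form k D z) (at z)" if "Im z > 0" for z
      using has_field_derivative_parts[of ?A z m t] has_field_derivative_eichler[OF a0 summable that] A0[OF that]
      by simp
  qed
  have line': "contour_integral (linepath u v) (\<lambda>z. (z - t) ^ m * form_sum k D z)
      = (parts m ?A t v - parts m ?A t u) / K"
    if "Im u > 0" "Im v > 0" for t u v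
  proof -
    have "contour_integral (linepath u v) (\<lambda>z. (z - t) ^ m * form_sum k D z)
        = parts m ?A t v / K - parts m ?A t u / K"
    proof (rule contour_integral_unique, rule has_contour_integral_primitive_upper[OF _ that])
      show "((\<lambda>v. parts m ?A t v / K) has_field_derivative (z - t) ^ m * form_sum k D z) (at z)" if "Im z > 0" for z
        using DERIV_cdivide[OF has_field_derivative_parts[of ?A z m t], of K]
          has_field_derivative_eichler[OF a0 summable that] A0[OF that] K0
        by (simp add: f)
    qed
    then show ?thesis by (simp only: diff_divide_distrib)
  qed

  \<comment> \<open>By the symmetries of \<open>form_sum\<close> the integrand is
    \<open>(z - (- t)) ^ m * f_form k D z\<close>. The boundary term at infinity vanishes, so only
    the lower limit contributes, with a minus sign.\<close>
  have nonhol: "nonhol_eichler k (f_form k D) t = - \<omega> * parts m ?A (- t) (- cnj t)" if t: "Im t > 0" for t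
  proof -
    have "cnj (f_form k D (- cnj z)) = f_form k D z" for z
      unfolding f_form_eq by (simp add: form_sum_reflect form_sum_cnj)
    then have fn: "(\<lambda>z. cnj (f_form k D (- cnj z)) * (z + t) ^ (2 * k - 2)) = (\<lambda>z. (z - (- t)) ^ m * f_form k D z)"
      by (simp only: m(1) diff_minus_eq_add mult.commute[of "f_form k D _"])
    let ?u = "- cnj t"
    have "((\<lambda>T. parts m ?A (- t) (?u + \<i> * of_real T)) \<longlongrightarrow> 0) at_top"
      by (rule parts_tendsto_0) (rule eichler_tendsto_0[OF a0 summable])
    then have "((\<lambda>T. parts m ?A (- t) (?u + \<i> * of_real T) - parts m ?A (- t) ?u)
        \<longlongrightarrow> 0 - parts m ?A (- t) ?u) at_top"
      by (intro tendsto_diff tendsto_const)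
    moreover have "\<forall>\<^sub>F T in at_top. parts m ?A (- t) (?u + \<i> * of_real T) - parts m ?A (- t) ?u
        = contour_integral (linepath ?u (?u + \<i> * of_real T)) (\<lambda>z. (z - (- t)) ^ m * f_form k D z)"
      using eventually_ge_at_top[of 0]
      by eventually_elim (rule line[symmetric], use t in auto)
    ultimately have "((\<lambda>T. contour_integral (linepath ?u (?u + \<i> * of_real T)) (\<lambda>z. (z - (- t)) ^ m * f_form k D z))
        \<longlongrightarrow> 0 - parts m ?A (- t) ?u) at_top"
      by (rule Lim_transform_eventually)
    from tendsto_Lim[OF _ this]
    have "Lim at_top (\<lambda>T. contour_integral (linepath ?u (?u + \<i> * of_real T)) (\<lambda>z. (z - (- t)) ^ m * f_form k D z))
        = - parts m ?A (- t) ?u" by simp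
    moreover have "(- 2 * \<i>) powi (1 - 2 * int k) = \<omega>"
      using power_int_minus_two_i[of k] k by (simp only: \<omega>_def m(2))
    ultimately show ?thesis
      unfolding nonhol_eichler_def fn by (simp only: mult_minus_left mult_minus_right)
  qed

  have hol: "hol_eichler k (f_form k D) t = (2 * of_real pi * \<i>) ^ Suc m * ?A (Suc m) t" if t: "Im t > 0" for t
  proof -
    let ?b = "\<lambda>n. a n / (2 * of_real pi * \<i> * of_nat n) ^ Suc m * nome t ^ n"
    have s: "summable ?b"
      by (rule eichler_abs_summable(2)[OF a0 summable norm_nome_less_1[OF t]])
    have "?A (Suc m) t = (\<Sum>n. ?b (Suc n))"
      unfolding eichler_def using suminf_split_head[OF s] a0 by simp
    then have "(2 * of_real pi * \<i>) ^ Suc m * ?A (Suc m) t = (\<Sum>n. (2 * of_real pi * \<i>) ^ Suc m * ?b (Suc n))"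
      by (simp only: suminf_mult[OF summable_Suc_iff[THEN iffD2, OF s]])
    also have "\<dots> = (\<Sum>n. a (Suc n) / of_nat (Suc n) ^ Suc m * nome t ^ Suc n)"
      by (intro suminf_cong) (simp only: power_mult_distrib, simp del: of_nat_Suc power_Suc)
    finally show ?thesis by (simp only: hol_eichler_def coeff m(2))
  qed

  \<comment> \<open>Summation over the forms on the component\<close>
  have C: "connected C" "C \<noteq> {}" "C \<subseteq> upper_half_plane - exceptional_set D"
    using in_components_connected[OF assms(5)] in_components_nonempty[OF assms(5)] in_components_subset[OF assms(5)] .
  have CH: "Im t > 0" if "t \<in> C" for t
    using C(3) that by (auto simp: upper_half_plane_def)
  have Cg: "geodesic_fun Q t \<noteq> 0" if "t \<in> C" "Q \<in> forms D" for t Q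
    using C(3) that by (auto simp: exceptional_set_def)
  obtain t0 where t0: "t0 \<in> C" using C(2) by blast
  note y0 = CH[OF t0]
  let ?I1 = "\<lambda>t Q. contour_integral (linepath (- cnj t0) (- cnj t)) (\<lambda>z. (z + t) ^ m * (1 / form_at Q (- z) ^ k))"
  let ?I2 = "\<lambda>t Q. contour_integral (linepath t0 t) (\<lambda>z. (z - t) ^ m * (1 / form_at Q z ^ k))"
  let ?J1 = "\<lambda>t. contour_integral (linepath (- cnj t0) (- cnj t)) (\<lambda>z. (z + t) ^ m * form_sum k D z)"
  let ?J2 = "\<lambda>t. contour_integral (linepath t0 t) (\<lambda>z. (z - t) ^ m * form_sum k D z)"
  have "\<forall>Q\<in>forms D. \<exists>p. degree p \<le> m \<and> (\<forall>t\<in>C. F_term k D t Q = poly p t - \<kappa> * ?I1 t Q - \<kappa> * ?I2 t Q)"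
    using F_term_eq[OF sq D k _ C(1) CH y0 Cg] unfolding \<kappa>_def m_def by blast
  from bchoice[OF this] obtain p where
    "\<forall>Q\<in>forms D. degree (p Q) \<le> m \<and> (\<forall>t\<in>C. F_term k D t Q = poly (p Q) t - \<kappa> * ?I1 t Q - \<kappa> * ?I2 t Q)" ..
  then have p: "\<And>Q. Q \<in> forms D \<Longrightarrow> degree (p Q) \<le> m"
    "\<And>Q t. Q \<in> forms D \<Longrightarrow> t \<in> C \<Longrightarrow> F_term k D t Q = poly (p Q) t - \<kappa> * ?I1 t Q - \<kappa> * ?I2 t Q"
    by (blast, blast)
  \<comment> \<open>The terms of the series and both families of integrals are summable over the
    forms, hence so are the values of the polynomials.\<close>
  have sum_p: "((\<lambda>Q. poly (p Q) t) has_sum infsum (F_term k D t) (forms D) + \<kappa> * ?J1 t + \<kappa> * ?J2 t) (forms D)"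
    if t: "t \<in> C" for t
  proof -
    note y = CH[OF t]
    have "(F_term k D t has_sum infsum (F_term k D t) (forms D)) (forms D)"
      using F_term_summable[OF sq D k y Cg[OF t]] by (rule has_sum_infsum)
    moreover have "((\<lambda>Q. \<kappa> * ?I1 t Q) has_sum \<kappa> * ?J1 t) (forms D)"
      by (rule has_sum_cmult_right[OF contour_integral_form_sum_reflect[OF sq D k]])
         (use y y0 in \<open>auto intro!: continuous_intros\<close>)
    moreover have "((\<lambda>Q. \<kappa> * ?I2 t Q) has_sum \<kappa> * ?J2 t) (forms D)"
      by (rule has_sum_cmult_right[OF contour_integral_form_sum[OF sq D k]])
         (use y y0 in \<open>auto intro!: continuous_intros\<close>)
    ultimately have "((\<lambda>Q. F_term k D t Q + \<kappa> * ?I1 t Q + \<kappa> * ?I2 t Q) has_sum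
        infsum (F_term k D t) (forms D) + \<kappa> * ?J1 t + \<kappa> * ?J2 t) (forms D)"
      by (intro has_sum_add)
    moreover have "F_term k D t Q + \<kappa> * ?I1 t Q + \<kappa> * ?I2 t Q = poly (p Q) t" if "Q \<in> forms D" for Q
      using p(2)[OF that t] by simp
    ultimately show ?thesis by (rule has_sum_cong[THEN iffD1, rotated])
  qed
  from has_sum_poly[OF False p(1) sum_p] obtain P where P: "degree P \<le> m"
    "\<And>t. t \<in> C \<Longrightarrow> infsum (F_term k D t) (forms D) + \<kappa> * ?J1 t + \<kappa> * ?J2 t = poly P t" by blast
  obtain p1 where p1: "degree p1 \<le> m" "\<And>t. poly p1 t = parts m ?A t (- cnj t0)"
    using parts_poly by blast
  obtain p2 where p2: "degree p2 \<le> m" "\<And>t. poly p2 t = parts m ?A t t0"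
    using parts_poly by blast
  \<comment> \<open>\<open>p1\<close> and \<open>p2\<close> collect the boundary terms at the base
    point; \<open>p1\<close> is taken at \<open>- t\<close>, the parameter of the reflected
    integral.\<close>
  define R where "R = smult (d / of_real N) P + smult (d * \<omega>) (pcompose p1 [:0, - 1:]) + smult (d * \<omega>) p2"
  have "degree R \<le> m"
  proof -
    have "degree (pcompose p1 [:0, - 1:]) \<le> m"
      using p1(1) degree_pcompose_le[of p1 "[:0, - 1:]"] by simp
    then show ?thesis
      unfolding R_def using P(1) p2(1)
      by (intro degree_add_le order_trans[OF degree_smult_le])
  qed
  moreover have "F_fun k D t = poly R t + d * nonhol_eichler k (f_form k D) t
       - d * of_real (fact m / (4 * pi) ^ Suc m) * hol_eichler k (f_form k D) t" if t: "t \<in> C" for t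
  proof -
    note y = CH[OF t]
    let ?X = "parts m ?A (- t) (- cnj t)"
    have J1: "\<kappa> * ?J1 t = of_real N * \<omega> * (?X - poly p1 (- t))"
      using line'[of "- cnj t0" "- cnj t" "- t"] y y0 K0 by (simp add: \<kappa> p1(2))
    \<comment> \<open>As \<open>m\<close> is even, the sign in \<open>parts_diagonal\<close> is
      +1.\<close>
    have J2: "\<kappa> * ?J2 t = of_real N * \<omega> * (fact m * ?A (Suc m) t - poly p2 t)"
      using line'[OF y0 y, of t] K0 by (simp add: \<kappa> p2(2) parts_diagonal m_def)
    have "F_fun k D t = d / of_real N * infsum (F_term k D t) (forms D)"
      by (simp add: F_fun_def F_term_def[abs_def] d_def N_def m(1))
    also have "\<dots> = d / of_real N * (poly P t - \<kappa> * ?J1 t - \<kappa> * ?J2 t)"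
      by (simp only: P(2)[OF t, symmetric]) simp
    also have "\<dots> = d / of_real N * poly P t - d * \<omega> * (?X - poly p1 (- t))
        - d * \<omega> * (fact m * ?A (Suc m) t - poly p2 t)"
      unfolding J1 J2 using N0 by (simp add: right_diff_distrib)
    also have "\<dots> = poly R t + d * (- \<omega> * ?X) - d * (\<omega> * fact m) * ?A (Suc m) t"
      by (simp add: R_def poly_pcompose algebra_simps)
    \<comment> \<open>The factor \<i>/2 in \<omega> times 4\<pi> is 2\<pi>\<i>, which converts the
      normalisation of \<open>eichler\<close> into that of \<open>hol_eichler\<close>.\<close>
    also have "\<omega> * fact m = of_real (fact m / (4 * pi) ^ Suc m) * (2 * of_real pi * \<i>) ^ Suc m"
    proof -
      have "\<i> / 2 * (4 * of_real pi) = 2 * of_real pi * \<i>" by simp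
      then have eq: "\<omega> * (4 * of_real pi) ^ Suc m = (2 * of_real pi * \<i>) ^ Suc m"
        unfolding \<omega>_def power_mult_distrib[symmetric] by (rule arg_cong)
      show ?thesis unfolding eq[symmetric] by simp
    qed
    finally show ?thesis
      unfolding nonhol[OF y] hol[OF y] by (simp only: mult.assoc)
  qed
  ultimately show ?thesis unfolding m d_def by blast
qed

end
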